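(* The map $F:[0,1/3]\cup[2/3,1]\to[0,1]$ constructed in the context is a $C^1$ expanding map (that is, $F$ is $C^1$, its restrictions to $[0,1/3]$ and to $[2/3,1]$ are diffeomorphisms onto $[0,1]$, and $F'>1$ on its domain) that satisfies the bounded distortion property BD but does not satisfy the strong bounded distortion property SBD.
   Context: Distortion properties. Let $I_0$ and $I_1$ be disjoint closed subintervals of $[0,1]$, with $I_0$ to the left of $I_1$, and let $F:I_0\cup I_1\to[0,1]$ be a $C^1$ map (one-sided derivatives at endpoints) such that each restriction $F|_{I_i}$ is a diffeomorphism onto $[0,1]$ and $F'>1$ on its domain. For $k\ge1$ let $\Omega_k$ be the set of words of length $k$ in the symbols $0$ and $1$. The $k$-th iterate $F^k$ is defined on a union of $2^k$ disjoint closed intervals $\{I_\omega:\omega\in\Omega_k\}$, labeled from left to right using the lexicographical order on $\Omega_k$; equivalently, for $\omega=\omega_1\cdots\omega_k$, $I_\omega=\{x: F^{i-1}(x)\in I_{\omega_i},\ 1\le i\le k\}$. Each $F^k|_{I_\omega}$ is a diffeomorphism onto $[0,1]$. BD: $F$ satisfies BD if there is a constant $1\le C<\infty$ such that $\frac{(F^k)'(x)}{(F^k)'(y)}\le C$ for all $k>0$, all $\omega\in\Omega_k$ and all $x,y\in I_\omega$. SBD: $F$ satisfies SBD if there is a sequence $(\beta_r)_{r\ge1}$ decreasing to $1$ such that, for all $k>0$ and all $r\geq 1$, $\frac{(F^k)'(x)}{(F^k)'(y)}\le\beta_r$ whenever $x,y$ belong to the same interval $I_\omega$, $\omega\in\Omega_k$,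 and $|F^k([x,y])|\le 1/r$, where $|A|$ denotes the diameter of $A$ (and $[x,y]$ is the closed interval with endpoints $x,y$). Construction of $F$. Let $X$ be the $C^\infty$ vector field on $[0,1]$ with $X(0)=X(1)=0$ and $X(x)=\exp\bigl((x(x-1))^{-1}\bigr)$ for $0<x<1$. Let $\{\varphi_t\}_{t\in\mathbb{R}}$ be its flow: for $x\in[0,1]$, $t\mapsto\varphi_t(x)$ is the solution of $\frac{d}{dt}\phi=X(\phi)$ with $\phi(0)=x$. Each $\varphi_t$ is a smooth diffeomorphism of $[0,1]$. Fix $0<T\le1$ such that $\varphi_t'(x)\ge 2/3$ for all $x\in[0,1]$ and all $t\in[-T,T]$ (such $T$ exists). For $n\ge0$ let $J_n=[2/3^{n+1},1/3^n]$ and $A_n:J_n\to[0,1]$, $A_n(x)=3^{n+1}x-2$; for $n\ge1$ let $B_n:[0,1]\to J_{n-1}$, $B_n(x)=(x+2)/3^n$. For $n\ge1$ with $2^k\le n<2^{k+1}$ ($k\ge0$ an integer), let $t_n=(-1/2)^kT$. Define $F:[0,1/3]\cup[2/3,1]\to[0,1]$ by $$F(x)=\begin{cases}B_n\circ\varphi_{t_n}\circ A_n(x), & x\in J_n,\ n\ge1,\\ 3x, & x\in[0,1/3]\setminus\bigcup_{n\ge1}J_n,\\ 3x-2, & x\in[2/3,1].\end{cases}$$ Here $I_0=[0,1/3]$ and $I_1=[2/3,1]$. *)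

theory Defs
  imports "HOL-Analysis.Analysis"
begin

section \<open>One-dimensional calculus on closed sets\<close>

text \<open>Derivatives are taken within the domain, so that they are one-sided at endpoints; the
  library's \<open>deriv\<close> and \<open>C1_differentiable_on\<close> are two-sided.\<close>

abbreviation deriv_within :: "real set \<Rightarrow> (real \<Rightarrow> real) \<Rightarrow> real \<Rightarrow> real" where
  "deriv_within S f x \<equiv> vector_derivative f (at x within S)"

definition C1_on :: "real set \<Rightarrow> (real \<Rightarrow> real) \<Rightarrow> bool" where
  "C1_on S f \<longleftrightarrow> f differentiable_on S \<and> continuous_on S (deriv_within S f)"

definition C1_diffeo :: "(real \<Rightarrow> real) \<Rightarrow> real set \<Rightarrow> real set \<Rightarrow> bool" where
  "C1_diffeo f A B \<longleftrightarrow> bij_betw f A B \<and> C1_on A f \<and> C1_on B (inv_into A f)"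

section \<open>Expanding maps with two branches and their distortion\<close>

text \<open>The branch domains are given as \<open>I 0\<close> and \<open>I 1\<close>; values of the total function
  \<open>F\<close> outside \<open>I 0 \<union> I 1\<close> are irrelevant.\<close>

definition C1_expanding :: "(nat \<Rightarrow> real set) \<Rightarrow> (real \<Rightarrow> real) \<Rightarrow> bool" where
  "C1_expanding I F \<longleftrightarrow>
     C1_on (I 0 \<union> I 1) F \<and>
     (\<forall>i\<in>{0, 1}. C1_diffeo F (I i) {0..1}) \<and>
     (\<forall>x\<in>I 0 \<union> I 1. deriv_within (I 0 \<union> I 1) F x > 1)"

definition words :: "nat \<Rightarrow> nat list set" where
  "words k = {w. length w = k \<and> set w \<subseteq> {0, 1}}"

definition cylinder :: "(nat \<Rightarrow> real set) \<Rightarrow> (real \<Rightarrow> real) \<Rightarrow> nat list \<Rightarrow> real set" where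
  "cylinder I F w = {x. \<forall>i<length w. (F ^^ i) x \<in> I (w ! i)}"

text \<open>Distinct cylinders of the same length are disjoint closed intervals, so the derivative of
  \<open>F ^^ k\<close> within a single cylinder is its derivative within its whole domain.\<close>

definition BD :: "(nat \<Rightarrow> real set) \<Rightarrow> (real \<Rightarrow> real) \<Rightarrow> bool" where
  "BD I F \<longleftrightarrow>
     (\<exists>C\<ge>1. \<forall>k>0. \<forall>w\<in>words k. \<forall>x\<in>cylinder I F w. \<forall>y\<in>cylinder I F w.
        deriv_within (cylinder I F w) (F ^^ k) x / deriv_within (cylinder I F w) (F ^^ k) y \<le> C)"

definition SBD :: "(nat \<Rightarrow> real set) \<Rightarrow> (real \<Rightarrow> real) \<Rightarrow> bool" where
  "SBD I F \<longleftrightarrow>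
     (\<exists>\<beta> :: nat \<Rightarrow> real. antimono_on {1..} \<beta> \<and> \<beta> \<longlonglongrightarrow> 1 \<and>
       (\<forall>k>0. \<forall>r\<ge>1. \<forall>w\<in>words k. \<forall>x\<in>cylinder I F w. \<forall>y\<in>cylinder I F w.
          diameter ((F ^^ k) ` closed_segment x y) \<le> 1 / real r \<longrightarrow>
          deriv_within (cylinder I F w) (F ^^ k) x / deriv_within (cylinder I F w) (F ^^ k) y
            \<le> \<beta> r))"

section \<open>The construction\<close>

definition X :: "real \<Rightarrow> real" where
  "X x = (if 0 < x \<and> x < 1 then exp (inverse (x * (x - 1))) else 0)"

definition solution :: "real \<Rightarrow> (real \<Rightarrow> real) \<Rightarrow> bool" where
  "solution x u \<longleftrightarrow>
     u 0 = x \<and> (\<forall>t. u t \<in> {0..1} \<and> (u has_real_derivative X (u t)) (at t))"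

text \<open>Meaningful for \<open>x \<in> {0..1}\<close>, where the solution exists for all times and is unique.\<close>

definition flow :: "real \<Rightarrow> real \<Rightarrow> real" where
  "flow t x = (THE u. solution x u) t"

definition admissible_T :: "real \<Rightarrow> bool" where
  "admissible_T T \<longleftrightarrow>
     0 < T \<and> T \<le> 1 \<and> (\<forall>t\<in>{-T..T}. \<forall>x\<in>{0..1}. deriv_within {0..1} (flow t) x \<ge> 2 / 3)"

definition J :: "nat \<Rightarrow> real set" where
  "J n = {2 / 3 ^ (n + 1) .. 1 / 3 ^ n}"

definition A :: "nat \<Rightarrow> real \<Rightarrow> real" where
  "A n x = 3 ^ (n + 1) * x - 2"

definition B :: "nat \<Rightarrow> real \<Rightarrow> real" where
  "B n x = (x + 2) / 3 ^ n"

definition time :: "real \<Rightarrow> nat \<Rightarrow> real" where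
  "time T n = (- 1 / 2) ^ (THE k :: nat. 2 ^ k \<le> n \<and> n < 2 ^ (k + 1)) * T"

definition branch :: "nat \<Rightarrow> real set" where
  "branch i = (if i = 0 then {0..1/3} else {2/3..1})"

text \<open>The intervals \<open>J n\<close> are pairwise disjoint, so the index chosen below is unique.\<close>

definition distF :: "real \<Rightarrow> real \<Rightarrow> real" where
  "distF T x =
     (if \<exists>n\<ge>1. x \<in> J n then
        (let n = (THE n. n \<ge> 1 \<and> x \<in> J n) in B n (flow (time T n) (A n x)))
      else if x \<in> {0..1/3} then 3 * x
      else 3 * x - 2)"

end

theory Submission
  imports Defs
begin

text \<open>On a point of J n the map F is a copy of the time \<open>t\<^sub>n\<close> map of the flow, so the charts A n
turn an iterate that follows a run of symbols 0 into a composition of time maps of one flow. By the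
group law this composition is a single time map, whose time is a difference of partial sums
\<open>s\<^sub>n = t\<^sub>1 + \<dots> + t\<^sub>n\<close> (\<open>clock\<close>; lemma \<open>orbit_J\<close>). The block of the \<open>2 ^ k\<close> times equal
to \<open>(-1/2) ^ k * T\<close> contributes T or -T alternately, so the partial sums run back and forth over the
interval from 0 to T (\<open>clock_bounds\<close>, \<open>clock_block_end\<close>) although the individual times
tend to 0. Each part of the theorem is one aspect of this.

\<^item> F is \<open>C\<^sup>1\<close> because the times tend to 0: the time maps then tend to the identity in the
\<open>C\<^sup>1\<close> sense, which gives derivative 3 at the only accumulation point 0 of the intervals J n. Away
from 0 the map is locally one conjugated time map of the flow, extended by the identity outside
the unit interval.

\<^item> Bounded distortion holds because the partial sums stay bounded. A run of symbols 0 followed by 1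
carries J n onto the unit interval by a time map with time in \<open>{0..T}\<close>, up to the affine
chart. Such maps distort by a factor whose logarithm is at most a constant times the distance of
the image points (\<open>first_return_distortion\<close>). Those distances decay geometrically in the number of
remaining symbols because F expands by at least 2, so the sum over all runs is bounded
(\<open>itinerary_distortion\<close>). An unfinished last run adds at most a constant (\<open>left_run_bound\<close>).

\<^item> Strong bounded distortion fails because the partial sums do not converge. A run of symbols 0 that
uses up exactly one block of times with positive sign is the time T map of the flow in the charts.
Its image lies in some J q and may be taken as short as desired, yet its distortion is that of the
time T map, which is not affine.

The derivative of the flow in the space variable is handled through its logarithm \<open>log_deriv t z\<close>.
In the interior this is \<open>ln (X (\<phi>\<^sub>t z)) - ln (X z)\<close>, and everywhere its derivative in t is
\<open>X'\<close> along the orbit. Bounds on \<open>X'\<close> and \<open>X''\<close> then control it by the mean value theorem in t.\<close>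

section \<open>The vector field\<close>

text \<open>The vector field is \<open>bump 0\<close> composed with \<open>x * (1 - x)\<close>. The family is closed under
differentiation up to linear combinations, so that one argument at the flat point 0 serves for all
derivatives of X.\<close>

definition bump :: "nat \<Rightarrow> real \<Rightarrow> real" where
  "bump n y = (if 0 < y then inverse y ^ n * exp (- inverse y) else 0)"

text \<open>One term of the exponential series. It is the source of all explicit bounds on X and its
derivatives.\<close>

lemma power_le_fact_exp:
  fixes u :: real
  assumes "0 \<le> u"
  shows "u ^ n \<le> fact n * exp u"
proof -
  have "(\<Sum>k\<in>{n}. inverse (fact k) * u ^ k) \<le> (\<Sum>k. inverse (fact k) * u ^ k)"
    by (rule sum_le_suminf) (use assms summable_exp[of u] in auto)
  also have "\<dots> = exp u" by (simp add: exp_def)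
  finally show ?thesis by (simp add: field_simps)
qed

lemma bump_bounds: "0 \<le> bump n y" "bump n y \<le> fact n"
proof -
  show "0 \<le> bump n y" by (simp add: bump_def)
  show "bump n y \<le> fact n"
    using power_le_fact_exp[of "inverse y" n] by (auto simp: bump_def exp_minus field_simps)
qed

lemma bump_DERIV: "(bump n has_real_derivative bump (n + 2) y - n * bump (n + 1) y) (at y)"
proof -
  consider "y < 0" | "y = 0" | "y > 0" by linarith
  then show ?thesis
  proof cases
    case 1
    have "(bump n has_real_derivative 0) (at y)"
      by (rule has_field_derivative_transform_within_open[of "\<lambda>_. 0" _ _ "{..<0}"])
         (use 1 in \<open>auto simp: bump_def\<close>)
    then show ?thesis using 1 by (simp add: bump_def)
  next
    case 2
    have "((\<lambda>h. bump n h / h) \<longlongrightarrow> 0) (at 0)"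
    proof (rule filterlim_split_at_real)
      show "((\<lambda>h. bump n h / h) \<longlongrightarrow> 0) (at_left 0)"
        by (rule tendsto_eventually) (auto simp: bump_def eventually_at_filter)
      have "((\<lambda>h. inverse h ^ (n+1) / exp (inverse h)) \<longlongrightarrow> (0::real)) (at_right 0)"
        by (rule filterlim_compose[OF tendsto_power_div_exp_0 filterlim_inverse_at_top_right])
      then show "((\<lambda>h. bump n h / h) \<longlongrightarrow> 0) (at_right 0)"
        by (rule Lim_transform_eventually)
           (auto simp: bump_def eventually_at_filter exp_minus field_simps)
    qed
    then show ?thesis using 2 by (simp add: has_field_derivative_iff bump_def)
  next
    case 3
    have "((\<lambda>y. inverse y ^ n * exp (- inverse y)) has_real_derivative
       bump (n + 2) y - n * bump (n + 1) y) (at y)"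
    proof (rule DERIV_cong[OF DERIV_mult])
      show "((\<lambda>y. inverse y ^ n) has_real_derivative
          of_nat n * (- (inverse y * 1 * inverse y) * inverse y ^ (n - Suc 0))) (at y)"
        by (rule DERIV_power, rule DERIV_inverse', rule DERIV_ident) (use 3 in simp)
      show "((\<lambda>y. exp (- inverse y)) has_real_derivative
          exp (- inverse y) * (inverse y * 1 * inverse y)) (at y)"
        using 3 by (auto intro!: derivative_eq_intros)
    qed (use 3 in \<open>cases n; simp add: bump_def algebra_simps power2_eq_square\<close>)
    then show ?thesis
      by (rule has_field_derivative_transform_within_open[of _ _ _ "{0<..}"])
         (use 3 in \<open>auto simp: bump_def\<close>)
  qed
qed

lemma X_bump: "X x = bump 0 (x * (1 - x))"
proof -
  have "0 < x \<and> x < 1 \<longleftrightarrow> 0 < x * (1 - x)"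
    by (auto simp: zero_less_mult_iff)
  moreover have "inverse (x * (x - 1)) = - inverse (x * (1 - x))"
    by (metis inverse_minus_eq minus_diff_eq mult_minus_right)
  ultimately show ?thesis by (simp add: X_def bump_def)
qed

definition X' :: "real \<Rightarrow> real" where
  "X' x = bump 2 (x * (1 - x)) * (1 - 2 * x)"

definition X'' :: "real \<Rightarrow> real" where
  "X'' x = (bump 4 (x * (1 - x)) - 2 * bump 3 (x * (1 - x))) * (1 - 2 * x)\<^sup>2
     - 2 * bump 2 (x * (1 - x))"

lemma X_DERIV: "(X has_real_derivative X' x) (at x)"
proof -
  have "((\<lambda>x. bump 0 (x * (1 - x))) has_real_derivative X' x) (at x)"
    by (rule DERIV_cong[OF DERIV_chain2[OF bump_DERIV]])
       (auto intro!: derivative_eq_intros simp: X'_def numeral_eq_Suc)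
  then show ?thesis by (simp add: X_bump[abs_def])
qed

lemma X'_DERIV: "(X' has_real_derivative X'' x) (at x)"
proof -
  have "((\<lambda>x. bump 2 (x * (1 - x))) has_real_derivative
      (bump 4 (x * (1 - x)) - 2 * bump 3 (x * (1 - x))) * (1 - 2 * x)) (at x)"
    by (rule DERIV_cong[OF DERIV_chain2[OF bump_DERIV]])
       (auto intro!: derivative_eq_intros simp: numeral_eq_Suc)
  then show ?thesis unfolding X'_def[abs_def]
    by (rule DERIV_cong[OF DERIV_mult])
       (auto intro!: derivative_eq_intros simp: X''_def power2_eq_square)
qed

lemma X_eq_0: "x \<le> 0 \<or> 1 \<le> x \<Longrightarrow> X x = 0"
  and X'_eq_0: "x \<le> 0 \<or> 1 \<le> x \<Longrightarrow> X' x = 0"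
  and X''_eq_0: "x \<le> 0 \<or> 1 \<le> x \<Longrightarrow> X'' x = 0"
proof -
  assume *: "x \<le> 0 \<or> 1 \<le> x"
  then have "x * (1 - x) \<le> 0" by (auto simp: mult_le_0_iff)
  then show "X x = 0" "X' x = 0" "X'' x = 0" by (simp_all add: X_bump X'_def X''_def bump_def)
qed

lemma X_nonneg: "0 \<le> X x" and X_le_1: "X x \<le> 1"
  using bump_bounds[of 0] by (simp_all add: X_bump)

lemma X_pos: "0 < x \<Longrightarrow> x < 1 \<Longrightarrow> 0 < X x"
  by (simp add: X_def)

lemma X_le: "0 < x \<Longrightarrow> x < 1 \<Longrightarrow> X x \<le> x * (1 - x)"
proof -
  assume "0 < x" "x < 1"
  then have y: "0 < x * (1 - x)" by simp
  show ?thesis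
    using power_le_fact_exp[of "inverse (x * (1 - x))" 1] y
    by (simp add: X_bump bump_def exp_minus field_simps)
qed

lemma X'_bound: "\<bar>X' x\<bar> \<le> 2"
proof (cases "0 < x \<and> x < 1")
  case True
  have "\<bar>bump 2 (x * (1 - x)) * (1 - 2 * x)\<bar> \<le> 2 * 1"
    unfolding abs_mult
    by (rule mult_mono) (use bump_bounds[of 2] True in \<open>auto simp: fact_numeral\<close>)
  then show ?thesis by (simp add: X'_def)
qed (use X'_eq_0 in force)

lemma X''_bound: "\<bar>X'' x\<bar> \<le> 40"
proof (cases "0 < x \<and> x < 1")
  case True
  let ?y = "x * (1 - x)"
  have "\<bar>bump 4 ?y - 2 * bump 3 ?y\<bar> \<le> 36"
    using bump_bounds[of 4 ?y] bump_bounds[of 3 ?y] by (simp add: fact_numeral)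
  moreover have "(1 - 2 * x)\<^sup>2 \<le> 1" using True by (intro power_le_one_iff[THEN iffD2] abs_square_le_1[THEN iffD2]) auto
  ultimately have "\<bar>(bump 4 ?y - 2 * bump 3 ?y) * (1 - 2 * x)\<^sup>2\<bar> \<le> 36 * 1"
    unfolding abs_mult by (intro mult_mono) auto
  then show ?thesis using bump_bounds[of 2 ?y] by (simp add: X''_def fact_numeral)
qed (use X''_eq_0 in force)

lemma X_lipschitz: "\<bar>X x - X y\<bar> \<le> 2 * \<bar>x - y\<bar>"
  using field_differentiable_bound[of UNIV X X' 2 x y] X_DERIV X'_bound by auto

lemma X'_lipschitz: "\<bar>X' x - X' y\<bar> \<le> 40 * \<bar>x - y\<bar>"
  using field_differentiable_bound[of UNIV X' X'' 40 x y] X'_DERIV X''_bound by auto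

lemma X_taylor: "\<bar>X y - X x - X' x * (y - x)\<bar> \<le> 40 * (y - x)\<^sup>2"
proof -
  let ?f = "\<lambda>z. X z - X' x * z"
  have "norm (?f y - ?f x) \<le> (40 * \<bar>y - x\<bar>) * norm (y - x)"
  proof (rule field_differentiable_bound)
    show "convex (closed_segment x y)" by simp
    fix z assume z: "z \<in> closed_segment x y"
    show "(?f has_field_derivative X' z - X' x) (at z within closed_segment x y)"
      by (auto intro!: derivative_eq_intros has_field_derivative_at_within[OF X_DERIV])
    have "\<bar>z - x\<bar> \<le> \<bar>y - x\<bar>" using z by (auto simp: closed_segment_eq_real_ivl split: if_splits)
    then show "norm (X' z - X' x) \<le> 40 * \<bar>y - x\<bar>"
      using X'_lipschitz[of z x] by simp
  qed auto
  moreover have "?f y - ?f x = X y - X x - X' x * (y - x)" by (simp add: algebra_simps)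
  ultimately show ?thesis by (simp add: power2_eq_square mult.assoc)
qed

section \<open>Existence and uniqueness for the flow\<close>

text \<open>The mean value inequality in the time variable, in the form in which all estimates along
orbits use it.\<close>

lemma abs_le_of_deriv_bound:
  fixes f f' :: "real \<Rightarrow> real"
  assumes "\<And>s. \<bar>s\<bar> \<le> \<bar>t\<bar> \<Longrightarrow> (f has_real_derivative f' s) (at s)"
    and "\<And>s. \<bar>s\<bar> \<le> \<bar>t\<bar> \<Longrightarrow> \<bar>f' s\<bar> \<le> C"
  shows "\<bar>f t - f 0\<bar> \<le> C * \<bar>t\<bar>"
proof -
  have "(f has_real_derivative f' s) (at s within {-\<bar>t\<bar>..\<bar>t\<bar>})" "\<bar>f' s\<bar> \<le> C"
    if "s \<in> {-\<bar>t\<bar>..\<bar>t\<bar>}" for s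
    using that assms[of s] by (auto intro: has_field_derivative_at_within)
  then have "norm (f t - f 0) \<le> C * norm (t - 0)"
    by (intro field_differentiable_bound[of "{-\<bar>t\<bar>..\<bar>t\<bar>}" f f']) auto
  then show ?thesis by simp
qed

text \<open>Solutions are considered on the whole line, where X is globally Lipschitz and vanishes outside
the unit interval. This spares boundary cases: the flow becomes the identity outside, and
every estimate holds for all points.\<close>

definition ode :: "(real \<Rightarrow> real) \<Rightarrow> bool" where
  "ode u \<longleftrightarrow> (\<forall>t. (u has_real_derivative X (u t)) (at t))"

text \<open>Gronwall's inequality in both time directions: \<open>exp (- c * t) * w t\<close> decreases and
\<open>exp (c * t) * w t\<close> increases.\<close>

lemma two_sided_gronwall:
  fixes w w' :: "real \<Rightarrow> real"
  assumes w: "\<And>t. (w has_real_derivative w' t) (at t)"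
    and b: "\<And>t. \<bar>w' t\<bar> \<le> c * w t"
  shows "w t \<le> exp (c * \<bar>t\<bar>) * w 0"
proof (cases "0 \<le> t")
  case True
  have "exp (- c * t) * w t \<le> exp (- c * 0) * w 0"
  proof (rule DERIV_nonpos_imp_nonincreasing[OF True])
    fix x
    have "((\<lambda>t. exp (- c * t) * w t) has_real_derivative exp (- c * x) * (w' x - c * w x)) (at x)"
      by (auto intro!: derivative_eq_intros w simp: algebra_simps)
    moreover have "exp (- c * x) * (w' x - c * w x) \<le> 0"
      using b[of x] by (intro mult_nonneg_nonpos) auto
    ultimately show "\<exists>y. ((\<lambda>t. exp (- c * t) * w t) has_real_derivative y) (at x) \<and> y \<le> 0" by blast
  qed
  then show ?thesis using True by (simp add: exp_minus field_simps)
next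
  case False
  have "exp (c * t) * w t \<le> exp (c * 0) * w 0"
  proof (rule DERIV_nonneg_imp_nondecreasing[where f="\<lambda>t. exp (c * t) * w t"])
    fix x
    have "((\<lambda>t. exp (c * t) * w t) has_real_derivative exp (c * x) * (w' x + c * w x)) (at x)"
      by (auto intro!: derivative_eq_intros w simp: algebra_simps)
    moreover have "0 \<le> exp (c * x) * (w' x + c * w x)"
      using b[of x] by (intro mult_nonneg_nonneg) auto
    ultimately show "\<exists>y. ((\<lambda>t. exp (c * t) * w t) has_real_derivative y) (at x) \<and> y \<ge> 0" by blast
  qed (use False in simp)
  then show ?thesis using False by (simp add: exp_minus field_simps)
qed

text \<open>Gronwall for the squared distance, which unlike the distance itself is differentiable.\<close>

lemma ode_dist:
  assumes "ode u" "ode v"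
  shows "\<bar>u t - v t\<bar> \<le> exp (2 * \<bar>t\<bar>) * \<bar>u 0 - v 0\<bar>"
proof -
  have "(u t - v t)\<^sup>2 \<le> exp (4 * \<bar>t\<bar>) * (u 0 - v 0)\<^sup>2"
  proof (rule two_sided_gronwall)
    fix t
    show "((\<lambda>t. (u t - v t)\<^sup>2) has_real_derivative 2 * (u t - v t) * (X (u t) - X (v t))) (at t)"
      using assms unfolding ode_def by (auto intro!: derivative_eq_intros)
    have "\<bar>2 * (u t - v t) * (X (u t) - X (v t))\<bar> \<le> 2 * \<bar>u t - v t\<bar> * (2 * \<bar>u t - v t\<bar>)"
      unfolding abs_mult using X_lipschitz by (intro mult_mono) auto
    then show "\<bar>2 * (u t - v t) * (X (u t) - X (v t))\<bar> \<le> 4 * (u t - v t)\<^sup>2"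
      by (simp add: power2_eq_square)
  qed
  also have "\<dots> = (exp (2 * \<bar>t\<bar>) * (u 0 - v 0))\<^sup>2"
    by (simp add: power_mult_distrib flip: exp_double)
  finally show ?thesis by (simp add: abs_le_square_iff[symmetric] abs_mult)
qed

lemma ode_unique: "ode u \<Longrightarrow> ode v \<Longrightarrow> u 0 = v 0 \<Longrightarrow> u = v"
  using ode_dist[of u v] by (intro ext) simp

lemma ode_const: "X z = 0 \<Longrightarrow> ode (\<lambda>_. z)"
  by (simp add: ode_def)

lemma ode_shift: "ode u \<Longrightarrow> ode (\<lambda>t. u (t + s))"
  unfolding ode_def by (intro allI DERIV_shift[THEN iffD1]) simp

text \<open>Inside the interval the equation is solved by separation of variables: solutions are the
inverse of an antiderivative of 1 / X, with shifted argument.\<close>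

lemma antiderivative_1_over_X:
  obtains G where "\<And>x. 0 < x \<Longrightarrow> x < 1 \<Longrightarrow> (G has_real_derivative inverse (X x)) (at x)"
proof -
  have "isCont (\<lambda>x. inverse (X x)) x" if "0 < x" "x < 1" for x
    using X_pos[OF that] DERIV_isCont[OF X_DERIV] by (auto intro!: continuous_intros)
  with einterval_antiderivative[of 0 1 "\<lambda>x. inverse (X x)"]
  show thesis using that
    by (auto simp: has_real_derivative_iff_has_vector_derivative zero_ereal_def one_ereal_def)
qed

text \<open>Solutions exist for all times because the antiderivative takes every real value. Since
\<open>X x \<le> x * (1 - x)\<close>, the antiderivative grows at least as fast as \<open>ln x - ln (1 - x)\<close>, whose
range is the whole line.\<close>

lemma antiderivative_onto:
  assumes G: "\<And>x. 0 < x \<Longrightarrow> x < 1 \<Longrightarrow> (G has_real_derivative inverse (X x)) (at x)"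
  shows "\<exists>x. 0 < x \<and> x < 1 \<and> G x = y"
proof -
  define l where "l x = ln x - ln (1 - x)" for x :: real
  have mono: "G a - l a \<le> G b - l b" if "0 < a" "a \<le> b" "b < 1" for a b
  proof (rule DERIV_nonneg_imp_nondecreasing[OF that(2)])
    fix x assume "a \<le> x" "x \<le> b"
    then have x: "0 < x" "x < 1" using that by auto
    have "((\<lambda>x. G x - l x) has_real_derivative inverse (X x) - inverse (x * (1 - x))) (at x)"
      unfolding l_def using x
      by (auto intro!: derivative_eq_intros G simp: field_simps)
    moreover have "inverse (x * (1 - x)) \<le> inverse (X x)"
      using X_le[OF x] X_pos[OF x] by (intro le_imp_inverse_le) auto
    ultimately show "\<exists>d. ((\<lambda>x. G x - l x) has_real_derivative d) (at x) \<and> 0 \<le> d"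
      by force
  qed
  define c where "c = \<bar>y\<bar> + \<bar>G (1/2)\<bar>"
  \<comment> \<open>the point at which \<open>l\<close> takes the value \<open>- c\<close>; by symmetry it is \<open>c\<close> at \<open>1 - a\<close>\<close>
  define a where "a = 1 / (1 + exp c)"
  have pos: "0 < 1 + exp c" by (simp add: add_pos_pos)
  have a: "0 < a" "a \<le> 1/2" "1 - a = exp c / (1 + exp c)"
    using pos by (simp_all add: a_def field_simps) (simp add: c_def)
  have l: "l a = - c" "l (1 - a) = c" "l (1/2) = 0"
  proof -
    have "ln a = - ln (1 + exp c)" "ln (1 - a) = c - ln (1 + exp c)"
      using pos unfolding a(3) by (simp_all add: a_def ln_div)
    then show "l a = - c" "l (1 - a) = c" "l (1/2) = 0" by (simp_all add: l_def)
  qed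
  have "G a - l a \<le> G (1/2) - l (1/2)" "G (1/2) - l (1/2) \<le> G (1 - a) - l (1 - a)"
    using a(1,2) by (auto intro!: mono)
  then have "G a \<le> y" "y \<le> G (1 - a)"
    unfolding l c_def by linarith+
  moreover have "continuous_on {a..1 - a} G"
    by (rule DERIV_atLeastAtMost_imp_continuous_on) (use a(1) in \<open>auto intro!: exI G\<close>)
  ultimately obtain x where "a \<le> x" "x \<le> 1 - a" "G x = y"
    using IVT'[of G a y "1 - a"] a by auto
  then show ?thesis using a by (intro exI[of _ x]) auto
qed

lemma ode_exists_interior:
  assumes z: "0 < z" "z < 1"
  shows "\<exists>u. ode u \<and> u 0 = z \<and> (\<forall>t. 0 < u t \<and> u t < 1)"
proof -
  obtain G where G: "\<And>x. 0 < x \<Longrightarrow> x < 1 \<Longrightarrow> (G has_real_derivative inverse (X x)) (at x)"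
    using antiderivative_1_over_X by blast
  have mono: "G a < G b" if "0 < a" "a < b" "b < 1" for a b
    by (rule DERIV_pos_imp_increasing[OF that(2)])
       (use that G X_pos in \<open>force intro!: exI[of _ "inverse (X _)"]\<close>)
  obtain H where H: "\<And>y. 0 < H y" "\<And>y. H y < 1" "\<And>y. G (H y) = y"
    using antiderivative_onto[OF G] by metis
  have HG: "H (G x) = x" if "0 < x" "x < 1" for x
    using mono[of "H (G x)" x] mono[of x "H (G x)"] that H[of "G x"] by fastforce
  have cont: "isCont H y" for y
  proof -
    define d where "d = min (H y / 2) ((1 - H y) / 2)"
    have d: "d > 0" "H y - d > 0" "H y + d < 1" using H(1,2)[of y] unfolding d_def by (auto simp: min_def field_simps)
    have "isCont H (G (H y))"
      by (rule isCont_inverse_function[where d=d and f=G and x="H y"])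
         (use d HG in \<open>auto simp: abs_le_iff intro!: DERIV_isCont[OF G]\<close>)
    then show ?thesis by (simp add: H)
  qed
  have dH: "(H has_real_derivative X (H y)) (at y)" for y
    using DERIV_inverse_function[where f=G and g=H and x=y and D="inverse (X (H y))"
        and a="y - 1" and b="y + 1"]
      G[OF H(1,2)] X_pos[OF H(1,2)[of y]] H(3) cont
    by auto
  have "ode (\<lambda>t. H (t + G z))"
    by (rule ode_shift) (use dH in \<open>simp add: ode_def\<close>)
  then show ?thesis using H HG[OF z] by (intro exI[of _ "\<lambda>t. H (t + G z)"]) auto
qed

text \<open>The flow on the whole line, equal to \<open>flow\<close> on the unit interval and to the identity outside
(\<open>flow_eq_Phi\<close>, \<open>Phi_outside\<close>).\<close>

definition Phi :: "real \<Rightarrow> real \<Rightarrow> real" where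
  "Phi t z = (SOME u. ode u \<and> u 0 = z) t"

lemma Phi_ode: "ode (\<lambda>t. Phi t z)" and Phi_0 [simp]: "Phi 0 z = z"
proof -
  have "\<exists>u. ode u \<and> u 0 = z"
  proof (cases "0 < z \<and> z < 1")
    case False
    then show ?thesis using X_eq_0[of z] by (intro exI[of _ "\<lambda>_. z"]) (auto intro: ode_const)
  qed (use ode_exists_interior in blast)
  then have "ode (SOME u. ode u \<and> u 0 = z) \<and> (SOME u. ode u \<and> u 0 = z) 0 = z"
    by (rule someI_ex)
  then show "ode (\<lambda>t. Phi t z)" "Phi 0 z = z" by (simp_all add: Phi_def)
qed

lemma Phi_DERIV_time: "((\<lambda>t. Phi t z) has_real_derivative X (Phi t z)) (at t)"
  using Phi_ode by (simp add: ode_def)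

lemma Phi_unique: "ode u \<Longrightarrow> u t = Phi t (u 0)"
  using ode_unique[OF _ Phi_ode, of u "u 0"] by (metis Phi_0)

lemma Phi_outside: "z \<le> 0 \<or> 1 \<le> z \<Longrightarrow> Phi t z = z"
  using Phi_unique[OF ode_const[OF X_eq_0]] by metis

lemma Phi_interior: "0 < z \<Longrightarrow> z < 1 \<Longrightarrow> 0 < Phi t z \<and> Phi t z < 1"
  using ode_exists_interior Phi_unique by metis

lemma Phi_mem: "z \<in> {0..1} \<Longrightarrow> Phi t z \<in> {0..1}"
  using Phi_interior[of z t] Phi_outside[of z t] by (cases "0 < z \<and> z < 1") auto

lemma Phi_add: "Phi (t + s) z = Phi t (Phi s z)"
  using Phi_unique[OF ode_shift[OF Phi_ode], of t s z] by simp

lemma Phi_lipschitz: "\<bar>Phi t z - Phi t w\<bar> \<le> exp (2 * \<bar>t\<bar>) * \<bar>z - w\<bar>"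
  using ode_dist[OF Phi_ode[of z] Phi_ode[of w], of t] by simp

lemma Phi_near_id: "\<bar>Phi t z - z\<bar> \<le> \<bar>t\<bar>"
  using abs_le_of_deriv_bound[of t "\<lambda>s. Phi s z" "\<lambda>s. X (Phi s z)" 1] Phi_DERIV_time X_nonneg X_le_1
  by auto

lemma flow_eq_Phi:
  assumes "z \<in> {0..1}"
  shows "flow t z = Phi t z"
proof -
  have "solution z (\<lambda>t. Phi t z)"
    using Phi_mem[OF assms] Phi_DERIV_time by (auto simp: solution_def)
  moreover have "u = (\<lambda>t. Phi t z)" if "solution z u" for u
    using that Phi_unique[of u] by (auto simp: solution_def ode_def)
  ultimately have "(THE u. solution z u) = (\<lambda>t. Phi t z)" by (rule the_equality)
  then show ?thesis by (simp add: flow_def)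
qed

section \<open>The derivative of the flow in space\<close>

text \<open>The logarithm of the space derivative of the time t map (\<open>Phi_DERIV\<close>). At the zeros of X
the value 0 is the right one because \<open>X'\<close> vanishes there as well.\<close>

definition log_deriv :: "real \<Rightarrow> real \<Rightarrow> real" where
  "log_deriv t z = (if 0 < z \<and> z < 1 then ln (X (Phi t z)) - ln (X z) else 0)"

lemma log_deriv_0 [simp]: "log_deriv 0 z = 0"
  by (simp add: log_deriv_def)

lemma log_deriv_outside: "z \<le> 0 \<or> 1 \<le> z \<Longrightarrow> log_deriv t z = 0"
  by (auto simp: log_deriv_def)

text \<open>This is the variational equation in logarithmic form. For interior points it is the chain
rule for \<open>ln (X (Phi t z))\<close>; at the other points both sides vanish.\<close>

lemma log_deriv_DERIV_time: "((\<lambda>t. log_deriv t z) has_real_derivative X' (Phi t z)) (at t)"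
proof (cases "0 < z \<and> z < 1")
  case True
  then have "0 < X (Phi t z)" using Phi_interior X_pos by simp
  then show ?thesis using True unfolding log_deriv_def
    by (auto intro!: derivative_eq_intros DERIV_chain2[OF X_DERIV Phi_DERIV_time])
next
  case False
  then show ?thesis using Phi_outside[of z t] X'_eq_0[of z] by (auto simp: log_deriv_def)
qed

text \<open>The cocycle identity: the chain rule for a composition of time maps, in logarithmic form.\<close>

lemma log_deriv_add: "log_deriv (t + s) z = log_deriv t (Phi s z) + log_deriv s z"
  using Phi_interior[of z s] Phi_outside[of z s] by (auto simp: log_deriv_def Phi_add)

lemma log_deriv_bound: "\<bar>log_deriv t z\<bar> \<le> 2 * \<bar>t\<bar>"
  using abs_le_of_deriv_bound[of t "\<lambda>s. log_deriv s z" "\<lambda>s. X' (Phi s z)" 2] log_deriv_DERIV_time X'_bound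
  by auto

lemma log_deriv_lipschitz: "\<bar>log_deriv t z - log_deriv t w\<bar> \<le> 40 * exp (2 * \<bar>t\<bar>) * \<bar>t\<bar> * \<bar>z - w\<bar>"
proof -
  have "\<bar>(log_deriv t z - log_deriv t w) - (log_deriv 0 z - log_deriv 0 w)\<bar> \<le> (40 * (exp (2 * \<bar>t\<bar>) * \<bar>z - w\<bar>)) * \<bar>t\<bar>"
  proof (rule abs_le_of_deriv_bound)
    fix s assume s: "\<bar>s\<bar> \<le> \<bar>t\<bar>"
    show "((\<lambda>s. log_deriv s z - log_deriv s w) has_real_derivative X' (Phi s z) - X' (Phi s w)) (at s)"
      by (intro DERIV_diff log_deriv_DERIV_time)
    have "\<bar>X' (Phi s z) - X' (Phi s w)\<bar> \<le> 40 * \<bar>Phi s z - Phi s w\<bar>" by (rule X'_lipschitz)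
    also have "\<dots> \<le> 40 * (exp (2 * \<bar>s\<bar>) * \<bar>z - w\<bar>)" using Phi_lipschitz by simp
    also have "\<dots> \<le> 40 * (exp (2 * \<bar>t\<bar>) * \<bar>z - w\<bar>)" using s by (intro mult_left_mono mult_right_mono) auto
    finally show "\<bar>X' (Phi s z) - X' (Phi s w)\<bar> \<le> 40 * (exp (2 * \<bar>t\<bar>) * \<bar>z - w\<bar>)" .
  qed
  then show ?thesis by (simp add: ac_simps)
qed

text \<open>The difference of two orbits, divided by the solution of the variational equation, has a time
derivative that is quadratic in the initial distance. This gives differentiability of the time
maps at every point, the zeros of X included, with no separate discussion of the boundary.\<close>

lemma Phi_variation:
  "\<bar>(Phi t w - Phi t z) * exp (- log_deriv t z) - (w - z)\<bar> \<le> 40 * exp (6 * \<bar>t\<bar>) * \<bar>t\<bar> * (w - z)\<^sup>2"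
proof -
  define d where "d s = Phi s w - Phi s z" for s
  have "\<bar>d t * exp (- log_deriv t z) - d 0 * exp (- log_deriv 0 z)\<bar> \<le> (40 * exp (6 * \<bar>t\<bar>) * (w - z)\<^sup>2) * \<bar>t\<bar>"
  proof (rule abs_le_of_deriv_bound)
    fix s assume s: "\<bar>s\<bar> \<le> \<bar>t\<bar>"
    let ?r = "X (Phi s w) - X (Phi s z) - X' (Phi s z) * d s"
    show "((\<lambda>s. d s * exp (- log_deriv s z)) has_real_derivative ?r * exp (- log_deriv s z)) (at s)"
      unfolding d_def
      by (auto intro!: derivative_eq_intros Phi_DERIV_time log_deriv_DERIV_time simp: algebra_simps)
    have "\<bar>d s\<bar> \<le> exp (2 * \<bar>t\<bar>) * \<bar>w - z\<bar>"
      using Phi_lipschitz[of s w z] s unfolding d_def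
      by (elim order_trans) (intro mult_right_mono, auto)
    then have "(d s)\<^sup>2 \<le> (exp (2 * \<bar>t\<bar>) * \<bar>w - z\<bar>)\<^sup>2"
      by (metis abs_ge_zero power_mono power2_abs)
    then have "(d s)\<^sup>2 \<le> exp (4 * \<bar>t\<bar>) * (w - z)\<^sup>2"
      by (simp add: power_mult_distrib flip: exp_double)
    then have "\<bar>?r\<bar> \<le> 40 * (exp (4 * \<bar>t\<bar>) * (w - z)\<^sup>2)"
      using X_taylor[of "Phi s w" "Phi s z"] unfolding d_def by linarith
    moreover have "exp (- log_deriv s z) \<le> exp (2 * \<bar>t\<bar>)" using log_deriv_bound[of s z] s by simp
    ultimately have "\<bar>?r\<bar> * exp (- log_deriv s z) \<le> 40 * (exp (4 * \<bar>t\<bar>) * (w - z)\<^sup>2) * exp (2 * \<bar>t\<bar>)"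
      by (intro mult_mono) auto
    also have "\<dots> = 40 * exp (4 * \<bar>t\<bar> + 2 * \<bar>t\<bar>) * (w - z)\<^sup>2"
      unfolding exp_add by simp
    finally show "\<bar>?r * exp (- log_deriv s z)\<bar> \<le> 40 * exp (6 * \<bar>t\<bar>) * (w - z)\<^sup>2"
      by (simp add: abs_mult)
  qed
  then show ?thesis by (simp add: d_def ac_simps)
qed

lemma Phi_DERIV: "(Phi t has_real_derivative exp (log_deriv t z)) (at z)"
proof -
  define C where "C = 40 * exp (6 * \<bar>t\<bar>) * \<bar>t\<bar> * exp (log_deriv t z)"
  have bd: "\<bar>(Phi t w - Phi t z) / (w - z) - exp (log_deriv t z)\<bar> \<le> C * \<bar>w - z\<bar>" if "w \<noteq> z" for w
  proof -
    have "(Phi t w - Phi t z) / (w - z) - exp (log_deriv t z)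
      = ((Phi t w - Phi t z) * exp (- log_deriv t z) - (w - z)) * exp (log_deriv t z) / (w - z)"
      using that by (simp add: field_simps exp_minus)
    also have "\<bar>\<dots>\<bar> = \<bar>(Phi t w - Phi t z) * exp (- log_deriv t z) - (w - z)\<bar> * exp (log_deriv t z) / \<bar>w - z\<bar>"
      by (simp add: abs_mult)
    also have "\<dots> \<le> 40 * exp (6 * \<bar>t\<bar>) * \<bar>t\<bar> * (w - z)\<^sup>2 * exp (log_deriv t z) / \<bar>w - z\<bar>"
      by (intro divide_right_mono mult_right_mono Phi_variation) auto
    also have "\<dots> = C * \<bar>w - z\<bar>"
    proof -
      have "(w - z)\<^sup>2 = \<bar>w - z\<bar> * \<bar>w - z\<bar>" by (simp add: power2_eq_square)
      then show ?thesis using that unfolding C_def by (simp del: abs_mult_self_eq)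
    qed
    finally show ?thesis .
  qed
  have "((\<lambda>w. C * \<bar>w - z\<bar>) \<longlongrightarrow> C * \<bar>z - z\<bar>) (at z)" by (intro tendsto_intros)
  then have "((\<lambda>w. C * \<bar>w - z\<bar>) \<longlongrightarrow> 0) (at z)" by simp
  then have "((\<lambda>w. (Phi t w - Phi t z) / (w - z) - exp (log_deriv t z)) \<longlongrightarrow> 0) (at z)"
    by (rule Lim_null_comparison[rotated]) (auto simp: eventually_at_filter bd)
  then show ?thesis by (simp add: has_field_derivative_iff Lim_null[symmetric])
qed

lemma isCont_log_deriv: "isCont (log_deriv t) z"
proof -
  have "((\<lambda>w. 40 * exp (2 * \<bar>t\<bar>) * \<bar>t\<bar> * \<bar>w - z\<bar>) \<longlongrightarrow> 40 * exp (2 * \<bar>t\<bar>) * \<bar>t\<bar> * \<bar>z - z\<bar>) (at z)"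
    by (intro tendsto_intros)
  then have "((\<lambda>w. 40 * exp (2 * \<bar>t\<bar>) * \<bar>t\<bar> * \<bar>w - z\<bar>) \<longlongrightarrow> 0) (at z)" by simp
  then have "((\<lambda>w. log_deriv t w - log_deriv t z) \<longlongrightarrow> 0) (at z)"
    by (rule Lim_null_comparison[rotated]) (simp add: log_deriv_lipschitz)
  then show ?thesis by (simp add: isCont_def Lim_null[symmetric])
qed

section \<open>Partial sums of the times\<close>

lemma dyadic_index:
  assumes "1 \<le> n"
  obtains k where "2 ^ k \<le> n" "n < (2::nat) ^ (k + 1)"
  using ex_power_ivl1[of 2 n] assms by auto

lemma time_eq:
  assumes "2 ^ k \<le> n" "n < 2 ^ (k + 1)"
  shows "time T n = (- 1 / 2) ^ k * T"
proof -
  have unique: "j = k" if "2 ^ j \<le> n \<and> n < 2 ^ (j + 1)" for j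
  proof -
    have "(2::nat) ^ j < 2 ^ (k + 1)" using that assms(2) by (meson le_less_trans)
    then have "j < k + 1" by (rule power_less_imp_less_exp[rotated]) simp
    moreover have "(2::nat) ^ k < 2 ^ (j + 1)" using that assms(1) by (meson le_less_trans)
    then have "k < j + 1" by (rule power_less_imp_less_exp[rotated]) simp
    ultimately show ?thesis by simp
  qed
  have "(THE k. 2 ^ k \<le> n \<and> n < 2 ^ (k + 1)) = k"
  proof (rule the_equality)
    show "2 ^ k \<le> n \<and> n < 2 ^ (k + 1)" using assms by simp
  qed (rule unique)
  then show ?thesis by (simp add: time_def)
qed

text \<open>With \<open>2 ^ k \<le> n < 2 ^ (k + 1)\<close>, the power \<open>1 / 2 ^ k\<close> is less than 2 / n.\<close>

lemma time_small:
  assumes "1 \<le> n"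
  shows "\<bar>time T n\<bar> \<le> 2 * \<bar>T\<bar> / real n"
proof -
  obtain k where k: "2 ^ k \<le> n" "n < 2 ^ (k + 1)" using dyadic_index[OF assms] .
  have "real n \<le> real (2 ^ (k + 1))" using k(2) by (intro of_nat_mono) simp
  then have "real n * \<bar>T\<bar> \<le> 2 * 2 ^ k * \<bar>T\<bar>"
    by (intro mult_right_mono) auto
  then have "\<bar>T\<bar> / 2 ^ k \<le> 2 * \<bar>T\<bar> / real n"
    using assms by (simp add: field_simps)
  then show ?thesis unfolding time_eq[OF k] by (simp add: abs_mult power_abs power_divide)
qed

definition clock :: "real \<Rightarrow> nat \<Rightarrow> real" where
  "clock T n = (\<Sum>j\<in>{1..n}. time T j)"

lemma clock_0 [simp]: "clock T 0 = 0"
  by (simp add: clock_def)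

lemma clock_Suc: "clock T (Suc n) = clock T n + time T (Suc n)"
  by (simp add: clock_def)

lemma clock_within_block:
  "r \<le> 2 ^ k \<Longrightarrow> clock T (2 ^ k - 1 + r) = clock T (2 ^ k - 1) + r * (- 1 / 2) ^ k * T"
proof (induction r)
  case (Suc r)
  have *: "2 ^ k - 1 + Suc r = Suc (2 ^ k - 1 + r)" by simp
  have "time T (Suc (2 ^ k - 1 + r)) = (- 1 / 2) ^ k * T"
    using Suc.prems by (intro time_eq) auto
  then show ?case using Suc unfolding * clock_Suc by (simp add: algebra_simps)
qed simp

text \<open>A full block of \<open>2 ^ k\<close> equal times adds up to T or -T, according to the parity of k.\<close>

lemma clock_block_end: "clock T (2 ^ k - 1) = (if even k then 0 else T)"
proof (induction k)
  case (Suc k)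
  have "2 ^ Suc k - 1 = 2 ^ k - 1 + (2::nat) ^ k" by simp
  then have "clock T (2 ^ Suc k - 1) = clock T (2 ^ k - 1) + 2 ^ k * (- 1 / 2) ^ k * T"
    using clock_within_block[of "2 ^ k" k T] by simp
  moreover have "2 ^ k * (- 1 / 2 :: real) ^ k = (- 1) ^ k"
    by (simp flip: power_mult_distrib)
  ultimately show ?case using Suc by auto
qed simp

text \<open>Within a block the partial sums move monotonically from one of the values 0 and T to the
other.\<close>

lemma clock_bounds:
  assumes "0 \<le> T"
  shows "clock T n \<in> {0..T}"
proof -
  obtain k where k: "2 ^ k \<le> n + 1" "n + 1 < 2 ^ (k + 1)" using dyadic_index[of "n + 1"] by auto
  define r where "r = n + 1 - 2 ^ k"
  have r: "n = 2 ^ k - 1 + r" "r \<le> 2 ^ k"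
    using k by (auto simp: r_def)
  define q where "q = real r / 2 ^ k"
  have "real r \<le> real (2 ^ k)" using r(2) by (rule of_nat_mono)
  then have "0 \<le> q" "q \<le> 1" by (simp_all add: q_def)
  then have q: "0 \<le> q * T" "q * T \<le> T"
    using assms mult_left_le_one_le[of T q] by simp_all
  have "clock T n = clock T (2 ^ k - 1) + r * (- 1 / 2) ^ k * T"
    using clock_within_block[OF r(2), of T] by (simp only: r(1)[symmetric])
  then have "clock T n = (if even k then q * T else T - q * T)"
    unfolding clock_block_end by (simp add: q_def power_divide)
  then show ?thesis using q by auto
qed

section \<open>The map near each interval of the construction\<close>

text \<open>An open neighbourhood of J n that meets no other interval of the family. The collars cover a right
neighbourhood of 0, gaps included, so that local properties of F at every positive point of the left
branch can be read off in a single collar.\<close>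

definition collar :: "nat \<Rightarrow> real set" where
  "collar n = {1 / 3 ^ (n + 1) <..< 2 / 3 ^ n}"

lemma third_mono: "m \<le> n \<Longrightarrow> (1::real) / 3 ^ n \<le> 1 / 3 ^ m"
  by (simp add: frac_le power_increasing)

lemma J_sub_collar: "J n \<subseteq> collar n"
proof
  fix x assume x: "x \<in> J n"
  have "(1::real) / 3 ^ (n + 1) < 2 / 3 ^ (n + 1)" "(1::real) / 3 ^ n < 2 / 3 ^ n"
    by (intro divide_strict_right_mono; simp)+
  with x show "x \<in> collar n" unfolding J_def collar_def by (metis atLeastAtMost_iff greaterThanLessThan_iff le_less_trans less_le_trans)
qed

lemma collar_J_index:
  assumes "x \<in> collar n" "x \<in> J m"
  shows "m = n"
proof (rule ccontr)
  assume "m \<noteq> n"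
  then consider "m + 1 \<le> n" | "n + 1 \<le> m" by linarith
  then show False
  proof cases
    case 1
    have "2 / 3 ^ (m + 1) \<le> x" "x < 2 * (1 / 3 ^ n)"
      using assms by (simp_all add: collar_def J_def)
    then show False using third_mono[OF 1] by simp
  next
    case 2
    have "x \<le> 1 / 3 ^ m" "1 / 3 ^ (n + 1) < x"
      using assms by (simp_all add: collar_def J_def)
    then show False using third_mono[OF 2] by linarith
  qed
qed

lemma J_index: "x \<in> J n \<Longrightarrow> x \<in> J m \<Longrightarrow> m = n"
  by (rule collar_J_index[OF subsetD[OF J_sub_collar]])

lemma collar_cover:
  assumes "0 < y" "y \<le> 1 / 3 ^ N"
  obtains n where "N \<le> n" "y \<in> collar n"
proof -
  define n where "n = (LEAST n. 1 / 3 ^ (n + 1) < y)"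
  obtain k where "(1 / 3) ^ k < y" using real_arch_pow_inv[OF assms(1), of "1/3"] by auto
  then have "1 / 3 ^ k < y" by (simp only: power_one_over)
  then have "1 / 3 ^ (k + 1) < y" by (rule le_less_trans[OF third_mono, rotated]) simp
  then have n: "1 / 3 ^ (n + 1) < y" unfolding n_def by (rule LeastI)
  have "N \<le> n"
  proof (rule ccontr)
    assume "\<not> N \<le> n"
    then have "(1::real) / 3 ^ N \<le> 1 / 3 ^ (n + 1)" by (intro third_mono) simp
    then show False using n assms(2) by (metis less_le_not_le order_trans)
  qed
  moreover have "y \<le> 1 / 3 ^ n"
  proof (cases n)
    case 0
    have "y \<le> 1 / 3 ^ 0" by (rule order_trans[OF assms(2) third_mono]) simp
    then show ?thesis unfolding 0 .
  next
    case (Suc m)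
    then have "\<not> 1 / 3 ^ (m + 1) < y" unfolding n_def by (intro not_less_Least) simp
    then show ?thesis using Suc by (simp only: not_less Suc_eq_plus1)
  qed
  moreover have "(1::real) / 3 ^ n < 2 / 3 ^ n" by (intro divide_strict_right_mono; simp)
  ultimately show thesis using n by (intro that[of n]) (auto simp only: collar_def greaterThanLessThan_iff)
qed

lemma collar_le_third: "n \<ge> 1 \<Longrightarrow> x \<in> collar n \<Longrightarrow> x < 2/3"
proof -
  assume "n \<ge> 1" "x \<in> collar n"
  then have "(1::real) / 3 ^ n \<le> 1 / 3" "x < 2 * (1 / 3 ^ n)"
    using third_mono[of 1 n] by (simp_all add: collar_def)
  then show ?thesis by linarith
qed

lemma J_le_third: "n \<ge> 1 \<Longrightarrow> x \<in> J n \<Longrightarrow> 0 < x \<and> x \<le> 1/3"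
proof -
  assume "n \<ge> 1" "x \<in> J n"
  then have "2 / 3 ^ (n + 1) \<le> x" by (simp add: J_def)
  then have "0 < x" by (rule less_le_trans[rotated]) simp
  moreover have "x \<le> 1 / 3 ^ n" "(1::real) / 3 ^ n \<le> 1 / 3"
    using third_mono[OF \<open>n \<ge> 1\<close>] \<open>x \<in> J n\<close> by (simp_all add: J_def)
  ultimately show ?thesis by linarith
qed

lemma A_mem_iff: "A n x \<in> {0..1} \<longleftrightarrow> x \<in> J n"
  by (auto simp: A_def J_def field_simps)

lemma B_A: "B n (A n x) = 3 * x"
  by (simp add: A_def B_def)

lemma A_B: "1 \<le> n \<Longrightarrow> A (n - 1) (B n z) = z"
  by (simp add: A_def B_def)

text \<open>The logarithm of F' / 3 (\<open>distF_DERIV\<close>), defined by the same case distinction as F.\<close>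

definition log_slope :: "real \<Rightarrow> real \<Rightarrow> real" where
  "log_slope T x = (if \<exists>n\<ge>1. x \<in> J n then
     (let n = (THE n. n \<ge> 1 \<and> x \<in> J n) in log_deriv (time T n) (A n x)) else 0)"

lemma the_J: "n \<ge> 1 \<Longrightarrow> x \<in> J n \<Longrightarrow> (THE n. n \<ge> 1 \<and> x \<in> J n) = n"
  using J_index by blast

lemma distF_J:
  assumes "n \<ge> 1" "x \<in> J n"
  shows "distF T x = B n (Phi (time T n) (A n x))"
proof -
  have "\<exists>n\<ge>1. x \<in> J n" using assms by blast
  then show ?thesis
    using assms A_mem_iff[of n x] unfolding distF_def the_J[OF assms] Let_def by (simp add: flow_eq_Phi)
qed

lemma log_slope_J:
  assumes "n \<ge> 1" "x \<in> J n"
  shows "log_slope T x = log_deriv (time T n) (A n x)"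
proof -
  have "\<exists>n\<ge>1. x \<in> J n" using assms by blast
  then show ?thesis unfolding log_slope_def the_J[OF assms] Let_def by simp
qed

lemma distF_off_J: "\<not> (\<exists>n\<ge>1. x \<in> J n) \<Longrightarrow> x \<in> {0..1/3} \<Longrightarrow> distF T x = 3 * x"
  unfolding distF_def by (simp only: if_False if_True)

lemma log_slope_off_J: "\<not> (\<exists>n\<ge>1. x \<in> J n) \<Longrightarrow> log_slope T x = 0"
  unfolding log_slope_def by (simp only: if_False)

lemma distF_right: "1/3 < x \<Longrightarrow> distF T x = 3 * x - 2"
  using J_le_third[of _ x] unfolding distF_def by force

lemma log_slope_right: "1/3 < x \<Longrightarrow> log_slope T x = 0"
  using J_le_third[of _ x] by (intro log_slope_off_J) force

text \<open>In the chart, the gaps on both sides of J n lie outside the unit interval, where the extended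
flow is the identity. So the formula for J n persists on the whole collar and F is differentiable across the
endpoints of J n.\<close>

lemma distF_collar:
  assumes "n \<ge> 1" "x \<in> collar n" "x \<le> 1/3"
  shows "distF T x = B n (Phi (time T n) (A n x))"
proof (cases "x \<in> J n")
  case True
  then show ?thesis using assms distF_J by blast
next
  case False
  then have "\<not> (\<exists>n\<ge>1. x \<in> J n)" using collar_J_index[OF assms(2)] by blast
  moreover have "0 < x" using assms(2) by (auto simp: collar_def intro: less_trans[of 0 "1 / 3 ^ (n + 1)"])
  ultimately have "distF T x = 3 * x" using assms by (intro distF_off_J) auto
  moreover have "Phi (time T n) (A n x) = A n x"
    using False A_mem_iff[of n x] by (intro Phi_outside) auto
  ultimately show ?thesis by (simp add: B_A)
qed

lemma log_slope_collar:
  assumes "n \<ge> 1" "x \<in> collar n"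
  shows "log_slope T x = log_deriv (time T n) (A n x)"
proof (cases "x \<in> J n")
  case True
  then show ?thesis using assms log_slope_J by blast
next
  case False
  then have "\<not> (\<exists>n\<ge>1. x \<in> J n)" using collar_J_index[OF assms(2)] by blast
  then have "log_slope T x = 0" by (rule log_slope_off_J)
  moreover have "log_deriv (time T n) (A n x) = 0"
    using False A_mem_iff[of n x] by (intro log_deriv_outside) auto
  ultimately show ?thesis by simp
qed

lemma zero_off_J: "\<not> (\<exists>n\<ge>1. 0 \<in> J n)"
  using J_le_third[of _ 0] by blast

lemma distF_0 [simp]: "distF T 0 = 0" and log_slope_0 [simp]: "log_slope T 0 = 0"
  using distF_off_J[OF zero_off_J] log_slope_off_J[OF zero_off_J] by simp_all

lemma distF_third: "distF T (1/3) = 1"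
proof -
  have "1/3 \<in> J 1" by (simp add: J_def)
  then show ?thesis by (simp add: distF_J[of 1] Phi_outside A_def B_def)
qed

text \<open>Points close to 0 lie in collars of large index, where the time is small and the time map is
\<open>C\<^sup>1\<close>-close to the identity. This gives differentiability of F at 0 and
continuity of the derivative there.\<close>

lemma near_zero:
  assumes "0 < y" "y \<le> 1 / 3 ^ N" "1 \<le> N"
  shows "\<bar>distF T y - 3 * y\<bar> \<le> 6 * \<bar>T\<bar> / N * y" "\<bar>log_slope T y\<bar> \<le> 4 * \<bar>T\<bar> / N"
proof -
  obtain n where n: "N \<le> n" "y \<in> collar n" using collar_cover[OF assms(1,2)] .
  have n1: "1 \<le> n" using n assms by simp
  have "y \<le> 1/3" using order_trans[OF assms(2) third_mono[OF assms(3)]] by simp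
  have t: "\<bar>time T n\<bar> \<le> 2 * \<bar>T\<bar> / N"
    using time_small[OF n1, of T] n(1) assms(3)
    by (elim order_trans) (auto intro!: divide_left_mono)
  have "\<bar>distF T y - 3 * y\<bar> = \<bar>Phi (time T n) (A n y) - A n y\<bar> / 3 ^ n"
    unfolding distF_collar[OF n1 n(2) \<open>y \<le> 1/3\<close>] by (subst B_A[of n, symmetric]) (simp add: B_def flip: diff_divide_distrib)
  also have "\<dots> \<le> (2 * \<bar>T\<bar> / N) * (1 / 3 ^ n)"
    unfolding divide_inverse[of _ "3 ^ n"] mult_1_left
    by (intro mult_right_mono order_trans[OF Phi_near_id t]) simp
  also have "\<dots> \<le> (2 * \<bar>T\<bar> / N) * (3 * y)"
    using n(2) by (intro mult_left_mono) (auto simp: collar_def)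
  finally show "\<bar>distF T y - 3 * y\<bar> \<le> 6 * \<bar>T\<bar> / N * y" by simp
  show "\<bar>log_slope T y\<bar> \<le> 4 * \<bar>T\<bar> / N"
    using log_deriv_bound[of "time T n" "A n y"] t unfolding log_slope_collar[OF n1 n(2)] by simp
qed

lemma DERIV_within_of_eq_on_open:
  assumes "(f has_real_derivative D) (at x)" "open V" "x \<in> V" "x \<in> S"
    and "\<And>y. y \<in> V \<inter> S \<Longrightarrow> f y = g y"
  shows "(g has_real_derivative D) (at x within S)"
proof -
  obtain d where "d > 0" "ball x d \<subseteq> V" using assms(2,3) open_contains_ball by blast
  then show ?thesis
    by (intro has_field_derivative_transform_within[OF has_field_derivative_at_within[OF assms(1)] \<open>d > 0\<close> assms(4)])
       (auto intro!: assms(5) simp: dist_commute subset_iff)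
qed

abbreviation domainF :: "real set" where
  "domainF \<equiv> {0..1/3} \<union> {2/3..1}"

lemma ex_nat_divide_less: "0 < (e::real) \<Longrightarrow> \<exists>N\<ge>1. c / real N < e"
proof -
  assume "0 < e"
  obtain N where "c / e < real N" using reals_Archimedean2 by blast
  then have "c / e < real (Suc N)" by simp
  then have "c / real (Suc N) < e" using \<open>0 < e\<close> by (simp add: field_simps)
  then show ?thesis by (intro exI[of _ "Suc N"]) auto
qed

lemma distF_DERIV:
  assumes "x \<in> domainF"
  shows "(distF T has_real_derivative 3 * exp (log_slope T x)) (at x within domainF)"
proof -
  consider "x = 0" | "0 < x" "x \<le> 1/3" | "1/3 < x" using assms by fastforce
  then show ?thesis
  proof cases
    case 1
    have "\<exists>d>0. \<forall>y\<in>domainF. 0 < dist y 0 \<and> dist y 0 < d \<longrightarrow> dist (distF T y / y) 3 < e"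
      if "0 < e" for e
    proof -
      obtain N where N: "N \<ge> 1" "6 * \<bar>T\<bar> / real N < e" using ex_nat_divide_less[OF \<open>0 < e\<close>] by blast
      have "dist (distF T y / y) 3 < e" if "y \<in> domainF" "y \<noteq> 0" "\<bar>y\<bar> < 1 / 3 ^ N" for y
      proof -
        have y: "0 < y" "y \<le> 1 / 3 ^ N" using that by auto
        have "\<bar>distF T y / y - 3\<bar> = \<bar>distF T y - 3 * y\<bar> / y"
          using y by (simp add: field_simps flip: abs_div_pos)
        also have "\<dots> \<le> 6 * \<bar>T\<bar> / N"
          using near_zero(1)[OF y N(1), of T] y by (simp add: field_simps)
        finally show ?thesis using N by (simp add: dist_real_def)
      qed
      then show ?thesis by (intro exI[of _ "1 / 3 ^ N"]) (auto simp: dist_real_def)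
    qed
    then show ?thesis unfolding 1 has_field_derivative_iff Lim_within by simp
  next
    case 2
    then obtain n where n: "1 \<le> n" "x \<in> collar n" using collar_cover[of x 1] by auto
    show ?thesis
    proof (rule DERIV_within_of_eq_on_open)
      show "((\<lambda>x. B n (Phi (time T n) (A n x))) has_real_derivative 3 * exp (log_slope T x)) (at x)"
        unfolding log_slope_collar[OF n] B_def A_def
        by (auto intro!: derivative_eq_intros DERIV_chain2[OF Phi_DERIV] simp: field_simps)
      show "B n (Phi (time T n) (A n y)) = distF T y" if "y \<in> collar n \<inter> domainF" for y
        using that collar_le_third[OF n(1), of y] by (intro distF_collar[symmetric] n(1)) auto
    qed (use n assms in \<open>auto simp: collar_def\<close>)
  next
    case 3
    show ?thesis
    proof (rule DERIV_within_of_eq_on_open)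
      show "((\<lambda>x. 3 * x - 2) has_real_derivative 3 * exp (log_slope T x)) (at x)"
        unfolding log_slope_right[OF 3] by (auto intro!: derivative_eq_intros)
    qed (use 3 assms in \<open>auto simp: distF_right intro: open_greaterThan[of "1/3"]\<close>)
  qed
qed

lemma log_slope_continuous: "continuous_on domainF (log_slope T)"
  unfolding continuous_on_def
proof
  fix x assume x: "x \<in> domainF"
  consider "x = 0" | "0 < x" "x \<le> 1/3" | "1/3 < x" using x by fastforce
  then show "(log_slope T \<longlongrightarrow> log_slope T x) (at x within domainF)"
  proof cases
    case 1
    have "\<exists>d>0. \<forall>y\<in>domainF. 0 < dist y 0 \<and> dist y 0 < d \<longrightarrow> dist (log_slope T y) 0 < e"
      if "0 < e" for e
    proof -
      obtain N where N: "N \<ge> 1" "4 * \<bar>T\<bar> / real N < e" using ex_nat_divide_less[OF \<open>0 < e\<close>] by blast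
      have "\<bar>log_slope T y\<bar> < e" if "y \<in> domainF" "y \<noteq> 0" "\<bar>y\<bar> < 1 / 3 ^ N" for y
        using near_zero(2)[of y N T] that N by auto
      then show ?thesis by (intro exI[of _ "1 / 3 ^ N"]) (auto simp: dist_real_def)
    qed
    then show ?thesis unfolding 1 Lim_within by simp
  next
    case 2
    then obtain n where n: "1 \<le> n" "x \<in> collar n" using collar_cover[of x 1] by auto
    have "isCont (\<lambda>x. log_deriv (time T n) (A n x)) x"
      unfolding A_def by (intro isCont_o2[OF _ isCont_log_deriv] continuous_intros)
    then have "((\<lambda>x. log_deriv (time T n) (A n x)) \<longlongrightarrow> log_slope T x) (at x within domainF)"
      unfolding log_slope_collar[OF n] isCont_def by (rule tendsto_within_subset) auto
    then show ?thesis
      by (rule Lim_transform_within_open[of _ _ _ _ "collar n"]) (use n log_slope_collar in \<open>auto simp: collar_def\<close>)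
  next
    case 3
    have "((\<lambda>_. 0) \<longlongrightarrow> log_slope T x) (at x within domainF)" using log_slope_right[OF 3] by simp
    then show ?thesis
      by (rule Lim_transform_within_open[of _ _ _ _ "{1/3<..}"]) (use 3 log_slope_right in auto)
  qed
qed

section \<open>The map is an expanding map\<close>

lemma islimpt_connected:
  fixes S :: "real set"
  assumes "connected S" "x \<in> S" "a \<in> S" "b \<in> S" "a \<noteq> b"
  shows "x islimpt S"
  using connected_imp_perfect[OF assms(1,2)] assms(3-5) by auto

lemma islimpt_Icc:
  fixes a b :: real
  assumes "a < b" "x \<in> {a..b}"
  shows "x islimpt {a..b}"
  by (rule islimpt_connected[of _ _ a b]) (use assms in auto)

lemma deriv_within_eq:
  assumes "(f has_real_derivative D) (at x within S)" "x islimpt S"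
  shows "deriv_within S f x = D"
  using vector_derivative_within[of x S f D] assms
  by (simp add: trivial_limit_within has_real_derivative_iff_has_vector_derivative)

lemma C1_onI:
  assumes "\<And>x. x \<in> S \<Longrightarrow> (f has_real_derivative f' x) (at x within S)"
    and "\<And>x. x \<in> S \<Longrightarrow> x islimpt S" and "continuous_on S f'"
  shows "C1_on S f"
proof -
  have "f differentiable_on S"
    unfolding differentiable_on_def differentiable_def
    by (intro ballI exI) (rule assms(1)[unfolded has_field_derivative_def])
  moreover have "continuous_on S (deriv_within S f)"
    using assms(3) by (rule continuous_on_eq) (simp add: deriv_within_eq[OF assms(1,2)])
  ultimately show ?thesis by (simp add: C1_on_def)
qed

lemma deriv_lower_bound_increment:
  fixes f f' :: "real \<Rightarrow> real"
  assumes "\<And>x. x \<in> {a..b} \<Longrightarrow> (f has_real_derivative f' x) (at x within {a..b})"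
    and "\<And>x. x \<in> {a..b} \<Longrightarrow> c \<le> f' x"
    and "a \<le> x" "x \<le> y" "y \<le> b"
  shows "c * (y - x) \<le> f y - f x"
proof (cases "x = y")
  case False
  then have xy: "x < y" using assms by simp
  have "\<exists>z\<in>{x<..<y}. f y - f x = (*) (f' z) (y - x)"
  proof (rule mvt_simple[OF xy])
    fix z assume "x \<le> z" "z \<le> y"
    then show "(f has_derivative (*) (f' z)) (at z within {x..y})"
      using assms DERIV_subset[OF assms(1)[of z], of "{x..y}"] by (auto simp: has_field_derivative_def)
  qed
  then obtain z where "z \<in> {x<..<y}" "f y - f x = f' z * (y - x)" by blast
  then show ?thesis using assms xy by (auto intro!: mult_right_mono)
qed simp

text \<open>A criterion for both branches at once. The inverse is continuous by compactness, and its
difference quotients are the reciprocals of those of f.\<close>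

lemma C1_diffeo_of_deriv_ge_1:
  fixes f f' :: "real \<Rightarrow> real"
  assumes "a < b"
    and D: "\<And>x. x \<in> {a..b} \<Longrightarrow> (f has_real_derivative f' x) (at x within {a..b})"
    and cont: "continuous_on {a..b} f'"
    and pos: "\<And>x. x \<in> {a..b} \<Longrightarrow> 1 \<le> f' x"
  shows "C1_diffeo f {a..b} {f a..f b}"
proof -
  let ?g = "inv_into {a..b} f"
  have less: "f x < f y" if "x \<in> {a..b}" "y \<in> {a..b}" "x < y" for x y
    using deriv_lower_bound_increment[of a b f f' 1 x y] D pos that by auto
  then have mono: "f x \<le> f y" if "x \<in> {a..b}" "y \<in> {a..b}" "x \<le> y" for x y
    using that by (cases "x = y") (auto simp: less_imp_le)
  have inj: "inj_on f {a..b}"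
  proof (rule linorder_inj_onI)
    show "f x \<noteq> f y" if "x < y" "x \<in> {a..b}" "y \<in> {a..b}" for x y
      using less[OF that(2,3,1)] by simp
  qed auto
  have fc: "continuous_on {a..b} f" using D by (rule DERIV_continuous_on)
  have im: "f ` {a..b} = {f a..f b}"
  proof
    show "f ` {a..b} \<subseteq> {f a..f b}" using mono \<open>a < b\<close> by auto
    show "{f a..f b} \<subseteq> f ` {a..b}"
    proof
      fix y assume "y \<in> {f a..f b}"
      then obtain x where "a \<le> x" "x \<le> b" "f x = y"
        using IVT'[of f a y b] fc \<open>a < b\<close> by auto
      then show "y \<in> f ` {a..b}" by auto
    qed
  qed
  have fab: "f a < f b" using less \<open>a < b\<close> by auto
  have gf: "?g (f x) = x" if "x \<in> {a..b}" for x using inj that by simp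
  have fg: "f (?g y) = y" and gm: "?g y \<in> {a..b}" if "y \<in> {f a..f b}" for y
    using f_inv_into_f[of y f "{a..b}", unfolded im, OF that]
      inv_into_into[of y f "{a..b}", unfolded im, OF that] .
  have gc: "continuous_on {f a..f b} ?g"
    using continuous_on_inv[OF fc, of ?g] gf im by simp
  have gD: "(?g has_real_derivative inverse (f' (?g y))) (at y within {f a..f b})"
    if y: "y \<in> {f a..f b}" for y
  proof -
    \<comment> \<open>substitution of \<open>?g\<close> in the difference quotient of \<open>f\<close>; injectivity keeps \<open>?g z\<close> off \<open>?g y\<close>\<close>
    have "filterlim ?g (at (?g y) within {a..b}) (at y within {f a..f b})"
      unfolding filterlim_at
    proof
      show "(?g \<longlongrightarrow> ?g y) (at y within {f a..f b})" using gc y by (auto simp: continuous_on_def)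
      show "\<forall>\<^sub>F x in at y within {f a..f b}. ?g x \<in> {a..b} \<and> ?g x \<noteq> ?g y"
        unfolding eventually_at_filter
      proof (rule always_eventually, intro allI impI conjI)
        fix z assume z: "z \<noteq> y" "z \<in> {f a..f b}"
        show "?g z \<in> {a..b}" by (rule gm[OF z(2)])
        show "?g z \<noteq> ?g y" using fg[OF z(2)] fg[OF y] z(1) by metis
      qed
    qed
    moreover have "((\<lambda>x. (f x - f (?g y)) / (x - ?g y)) \<longlongrightarrow> f' (?g y)) (at (?g y) within {a..b})"
      using D[OF gm[OF y]] by (simp add: has_field_derivative_iff)
    ultimately have "((\<lambda>z. (f (?g z) - f (?g y)) / (?g z - ?g y)) \<longlongrightarrow> f' (?g y)) (at y within {f a..f b})"
      by (rule filterlim_compose[rotated])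
    then have "((\<lambda>z. inverse ((f (?g z) - f (?g y)) / (?g z - ?g y))) \<longlongrightarrow> inverse (f' (?g y)))
        (at y within {f a..f b})"
      by (rule tendsto_inverse) (use pos[OF gm[OF y]] in linarith)
    moreover have "\<forall>\<^sub>F z in at y within {f a..f b}.
        inverse ((f (?g z) - f (?g y)) / (?g z - ?g y)) = (?g z - ?g y) / (z - y)"
      unfolding eventually_at_filter
    proof (rule always_eventually, intro allI impI)
      fix z assume "z \<in> {f a..f b}"
      then show "inverse ((f (?g z) - f (?g y)) / (?g z - ?g y)) = (?g z - ?g y) / (z - y)"
        by (simp only: fg[OF y] fg inverse_divide)
    qed
    ultimately show ?thesis unfolding has_field_derivative_iff
      by (rule Lim_transform_eventually)
  qed
  have "C1_on {a..b} f"
    by (rule C1_onI[OF D islimpt_Icc[OF \<open>a < b\<close>] cont])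
  moreover have "C1_on {f a..f b} ?g"
  proof (rule C1_onI[OF gD islimpt_Icc[OF fab]])
    show "continuous_on {f a..f b} (\<lambda>y. inverse (f' (?g y)))"
    proof (rule continuous_on_inverse)
      show "continuous_on {f a..f b} (\<lambda>y. f' (?g y))"
        by (rule continuous_on_compose2[OF cont gc]) (use gm in blast)
      show "\<forall>y\<in>{f a..f b}. f' (?g y) \<noteq> 0"
      proof
        fix y assume "y \<in> {f a..f b}"
        then show "f' (?g y) \<noteq> 0" using pos[OF gm] by force
      qed
    qed
  qed
  moreover have "bij_betw f {a..b} {f a..f b}" using inj im by (simp add: bij_betw_def)
  ultimately show ?thesis by (simp add: C1_diffeo_def)
qed

lemma domainF_branch: "branch 0 \<union> branch 1 = domainF"
  by (simp add: branch_def)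

lemma domainF_limpt: "x \<in> domainF \<Longrightarrow> x islimpt domainF"
  unfolding islimpt_Un using islimpt_Icc[of 0 "1/3" x] islimpt_Icc[of "2/3" 1 x] by auto

lemma flow_deriv:
  assumes "z \<in> {0..1}"
  shows "deriv_within {0..1} (flow t) z = exp (log_deriv t z)"
proof (rule deriv_within_eq)
  show "(flow t has_real_derivative exp (log_deriv t z)) (at z within {0..1})"
    by (rule has_field_derivative_transform_within[OF has_field_derivative_at_within[OF Phi_DERIV], of 1])
       (use assms in \<open>auto simp: flow_eq_Phi\<close>)
  show "z islimpt {0..1}" using islimpt_Icc[of 0 1 z] assms by simp
qed

text \<open>Since \<open>\<bar>X'\<bar> \<le> 2\<close>, the derivative of the time t map is at least
\<open>exp (- 2 * \<bar>t\<bar>) \<ge> 1 - 2 * \<bar>t\<bar>\<close>, which is 4/5 for \<open>\<bar>t\<bar> = 1/10\<close>.\<close>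

lemma admissible_exists: "admissible_T (1/10)"
proof -
  have "2/3 \<le> exp (log_deriv t z)" if "\<bar>t\<bar> \<le> 1/10" for t z
    using log_deriv_bound[of t z] that exp_ge_add_one_self[of "log_deriv t z"] by linarith
  then show ?thesis by (auto simp: admissible_T_def flow_deriv)
qed

lemma time_bound:
  assumes "1 \<le> n"
  shows "\<bar>time T n\<bar> \<le> \<bar>T\<bar>"
proof -
  obtain k where k: "2 ^ k \<le> n" "n < 2 ^ (k + 1)" using dyadic_index[OF assms] .
  show ?thesis unfolding time_eq[OF k] by (auto simp: abs_mult power_abs intro!: mult_left_le_one_le power_le_one)
qed

lemma distF_deriv_ge_2:
  assumes "admissible_T T"
  shows "2 \<le> 3 * exp (log_slope T x)"
proof (cases "\<exists>n\<ge>1. x \<in> J n")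
  case True
  then obtain n where n: "n \<ge> 1" "x \<in> J n" by blast
  then have "A n x \<in> {0..1}" by (simp only: A_mem_iff)
  moreover have "time T n \<in> {-T..T}"
    using time_bound[OF n(1), of T] assms by (auto simp: admissible_T_def abs_le_iff)
  ultimately have "2/3 \<le> exp (log_deriv (time T n) (A n x))"
    using assms flow_deriv unfolding admissible_T_def by metis
  then show ?thesis using log_slope_J[OF n] by simp
qed (simp add: log_slope_off_J)

lemma distF_expanding:
  assumes "admissible_T T"
  shows "C1_expanding branch (distF T)"
proof -
  have cont: "continuous_on domainF (\<lambda>x. 3 * exp (log_slope T x))"
    by (intro continuous_intros log_slope_continuous)
  have g: "1 < 3 * exp (log_slope T x)" for x using distF_deriv_ge_2[OF assms, of x] by simp
  have diffeo: "C1_diffeo (distF T) {a..b} {distF T a..distF T b}" if "a < b" "{a..b} \<subseteq> domainF" for a b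
  proof (rule C1_diffeo_of_deriv_ge_1[OF that(1)])
    show "(distF T has_real_derivative 3 * exp (log_slope T x)) (at x within {a..b})" if "x \<in> {a..b}" for x
      using distF_DERIV DERIV_subset \<open>{a..b} \<subseteq> domainF\<close> that by blast
    show "continuous_on {a..b} (\<lambda>x. 3 * exp (log_slope T x))"
      using cont that(2) by (rule continuous_on_subset)
  qed (use g in \<open>auto simp: less_imp_le\<close>)
  have "C1_on domainF (distF T)"
    using distF_DERIV domainF_limpt cont by (rule C1_onI)
  moreover have "C1_diffeo (distF T) (branch i) {0..1}" if "i \<in> {0, 1}" for i
    using that diffeo[of 0 "1/3"] diffeo[of "2/3" 1] distF_third[of T]
    by (auto simp: branch_def distF_right)
  moreover have "deriv_within domainF (distF T) x > 1" if "x \<in> domainF" for x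
    unfolding deriv_within_eq[OF distF_DERIV[OF that] domainF_limpt[OF that]] by (rule g)
  ultimately show ?thesis unfolding C1_expanding_def domainF_branch by simp
qed

section \<open>Runs of zeros\<close>

lemma distF_step:
  assumes "n \<ge> 1" "x \<in> J n"
  shows "A (n - 1) (distF T x) = Phi (time T n) (A n x)" "distF T x \<in> J (n - 1)"
proof -
  show *: "A (n - 1) (distF T x) = Phi (time T n) (A n x)"
    unfolding distF_J[OF assms] by (rule A_B[OF assms(1)])
  have "A n x \<in> {0..1}" using assms(2) by (simp only: A_mem_iff)
  then show "distF T x \<in> J (n - 1)" by (simp only: A_mem_iff[symmetric] * Phi_mem)
qed

text \<open>The sum of \<open>log_slope\<close> along an orbit: by the chain rule the derivative of the k-th iterate is
\<open>3 ^ k * exp (birkhoff T k x)\<close> (\<open>iterate_deriv\<close>), so distortion is a difference of these sums.\<close>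

definition birkhoff :: "real \<Rightarrow> nat \<Rightarrow> real \<Rightarrow> real" where
  "birkhoff T k x = (\<Sum>i<k. log_slope T ((distF T ^^ i) x))"

lemma birkhoff_simps [simp]:
  "birkhoff T 0 x = 0"
  "birkhoff T (Suc k) x = birkhoff T k x + log_slope T ((distF T ^^ k) x)"
  by (simp_all add: birkhoff_def)

lemma birkhoff_add: "birkhoff T (a + b) x = birkhoff T a x + birkhoff T b ((distF T ^^ a) x)"
proof (induction b)
  case (Suc b)
  have "(distF T ^^ (a + b)) x = (distF T ^^ b) ((distF T ^^ a) x)"
    by (metis add.commute comp_apply funpow_add)
  then show ?case using Suc by simp
qed simp

text \<open>The central computation. In the charts, p steps from J n to J (n - p) compose the time maps
with times \<open>t\<^sub>n, \<dots>, t\<^bsub>n-p+1\<^esub>\<close>. These commute and form a single time map of the flow, both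
for the points and for the logarithmic derivatives.\<close>

lemma orbit_J:
  assumes "x \<in> J n" "p \<le> n"
  shows "(distF T ^^ p) x \<in> J (n - p)"
    and "A (n - p) ((distF T ^^ p) x) = Phi (clock T n - clock T (n - p)) (A n x)"
    and "birkhoff T p x = log_deriv (clock T n - clock T (n - p)) (A n x)"
proof -
  have "(distF T ^^ p) x \<in> J (n - p) \<and>
      A (n - p) ((distF T ^^ p) x) = Phi (clock T n - clock T (n - p)) (A n x) \<and>
      birkhoff T p x = log_deriv (clock T n - clock T (n - p)) (A n x)"
    using assms(2)
  proof (induction p)
    case (Suc p)
    define y where "y = (distF T ^^ p) x"
    have IH: "y \<in> J (n - p)" "A (n - p) y = Phi (clock T n - clock T (n - p)) (A n x)"
        "birkhoff T p x = log_deriv (clock T n - clock T (n - p)) (A n x)"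
      using Suc by (simp_all add: y_def)
    have n: "n - p \<ge> 1" "n - p - 1 = n - Suc p" "n - p = Suc (n - Suc p)" using Suc.prems by auto
    have c: "clock T n - clock T (n - Suc p) = time T (n - p) + (clock T n - clock T (n - p))"
      unfolding n(3) clock_Suc by simp
    have "A (n - Suc p) (distF T y) = Phi (clock T n - clock T (n - Suc p)) (A n x)"
      using distF_step(1)[OF n(1) IH(1), of T] unfolding n(2) c Phi_add IH(2) .
    moreover have "distF T y \<in> J (n - Suc p)"
      using distF_step(2)[OF n(1) IH(1), of T] unfolding n(2) .
    moreover have "birkhoff T (Suc p) x = log_deriv (clock T n - clock T (n - Suc p)) (A n x)"
      unfolding c log_deriv_add birkhoff_simps IH(3) y_def[symmetric] log_slope_J[OF n(1) IH(1)] IH(2) by simp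
    ultimately show ?case by (simp add: y_def)
  qed (use assms(1) in simp)
  then show "(distF T ^^ p) x \<in> J (n - p)"
    "A (n - p) ((distF T ^^ p) x) = Phi (clock T n - clock T (n - p)) (A n x)"
    "birkhoff T p x = log_deriv (clock T n - clock T (n - p)) (A n x)" by simp_all
qed

lemma J_preimage:
  assumes "x \<in> {0..1/3}" "distF T x \<in> J n"
  shows "x \<in> J (Suc n)"
proof (cases "\<exists>m\<ge>1. x \<in> J m")
  case True
  then obtain m where m: "m \<ge> 1" "x \<in> J m" by blast
  have "m - 1 = n" by (rule J_index[OF assms(2) distF_step(2)[OF m]])
  then have "m = Suc n" using m(1) by linarith
  then show ?thesis using m(2) by simp
next
  case False
  then have "3 * x \<in> J n" using distF_off_J[OF False assms(1)] assms(2) by simp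
  then show ?thesis by (simp add: J_def field_simps)
qed

text \<open>While an orbit stays in the left branch it can enter J n only from J (n + 1): in the gaps F is
multiplication by 3, which carries each gap between two members of the family onto the next gap
to the right.\<close>

lemma J_pullback:
  assumes "\<And>i. i < m \<Longrightarrow> (distF T ^^ i) x \<in> {0..1/3}" "(distF T ^^ m) x \<in> J n"
  shows "x \<in> J (n + m)"
  using assms
proof (induction m arbitrary: n)
  case (Suc m)
  have "(distF T ^^ m) x \<in> J (Suc n)"
    by (rule J_preimage[of _ T]) (use Suc.prems in simp_all)
  then have "x \<in> J (Suc n + m)" using Suc.prems(1) by (intro Suc.IH) simp_all
  then show ?case by simp
qed simp

lemma clock_diff_bound:
  assumes "0 \<le> T"
  shows "\<bar>clock T m - clock T n\<bar> \<le> T"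
  using clock_bounds[OF assms, of m] clock_bounds[OF assms, of n] by (auto simp: abs_le_iff)

lemma J_0: "J 0 = {2/3..1}"
  by (simp add: J_def)

text \<open>Either the orbit meets no J n during the run and all its contributions vanish, or it passes
through consecutive members of the family from the start, and the sum is a value of \<open>log_deriv\<close>
at a time of absolute value at most T. The run cannot be longer than the index of the first J n, because J 0 is outside
the left branch.\<close>

lemma left_run_bound:
  assumes "0 \<le> T" "\<And>i. i < k \<Longrightarrow> (distF T ^^ i) x \<in> {0..1/3}"
  shows "\<bar>birkhoff T k x\<bar> \<le> 2 * T"
proof (cases "\<exists>i<k. \<exists>n\<ge>1. (distF T ^^ i) x \<in> J n")
  case True
  then obtain i n where i: "i < k" "(distF T ^^ i) x \<in> J n" by blast
  have x: "x \<in> J (n + i)" using J_pullback[of i T x n] assms(2) i by simp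
  have "k \<le> n + i"
  proof (rule ccontr)
    assume "\<not> k \<le> n + i"
    then have "(distF T ^^ (n + i)) x \<in> {0..1/3}" by (intro assms(2)) simp
    moreover have "(distF T ^^ (n + i)) x \<in> J 0" using orbit_J(1)[OF x order_refl] by simp
    ultimately show False by (simp add: J_0)
  qed
  show ?thesis
    unfolding orbit_J(3)[OF x \<open>k \<le> n + i\<close>]
    by (rule order_trans[OF log_deriv_bound]) (simp add: clock_diff_bound[OF assms(1)])
next
  case False
  have "log_slope T ((distF T ^^ i) x) = 0" if "i < k" for i
    by (rule log_slope_off_J) (use False that in blast)
  then have "birkhoff T k x = 0" unfolding birkhoff_def by (intro sum.neutral) simp
  then show ?thesis using assms(1) by simp
qed

section \<open>Bounded distortion along itineraries\<close>

definition same_itinerary :: "real \<Rightarrow> nat \<Rightarrow> real \<Rightarrow> real \<Rightarrow> bool" where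
  "same_itinerary T k x y \<longleftrightarrow> (\<forall>i<k. \<exists>j\<in>{0,1}.
     (distF T ^^ i) x \<in> branch j \<and> (distF T ^^ i) y \<in> branch j)"

lemma branch_Icc: "\<exists>a b. branch j = {a..b} \<and> {a..b} \<subseteq> domainF"
proof (cases "j = 0")
  case True
  then have "branch j = {0..1/3} \<and> {0..1/3} \<subseteq> domainF" by (simp add: branch_def)
  then show ?thesis by blast
next
  case False
  then have "branch j = {2/3..1} \<and> {2/3..1} \<subseteq> domainF" by (simp add: branch_def)
  then show ?thesis by blast
qed

lemma distF_expands:
  assumes "admissible_T T" "j \<in> {0, 1}" "x \<in> branch j" "y \<in> branch j" "x \<le> y"
  shows "2 * (y - x) \<le> distF T y - distF T x"
proof -
  obtain a b where ab: "branch j = {a..b}" "{a..b} \<subseteq> domainF" using branch_Icc[of j] by blast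
  show ?thesis
  proof (rule deriv_lower_bound_increment)
    show "(distF T has_real_derivative 3 * exp (log_slope T z)) (at z within {a..b})" if "z \<in> {a..b}" for z
      using distF_DERIV DERIV_subset ab(2) that by blast
  qed (use assms ab distF_deriv_ge_2 in auto)
qed

lemma distF_mono:
  assumes "admissible_T T" "j \<in> {0, 1}" "x \<in> branch j" "y \<in> branch j" "x \<le> y"
  shows "distF T x \<le> distF T y"
  using distF_expands[OF assms] assms(5) by simp

lemma distF_image:
  assumes "admissible_T T" "j \<in> {0, 1}"
  shows "distF T ` branch j = {0..1}"
  using distF_expanding[OF assms(1)] assms(2)
  unfolding C1_expanding_def C1_diffeo_def by (blast dest: bij_betw_imp_surj_on)

lemma itinerary_expands:
  assumes "admissible_T T" "same_itinerary T k x y"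
  shows "2 ^ k * \<bar>x - y\<bar> \<le> \<bar>(distF T ^^ k) x - (distF T ^^ k) y\<bar>"
  using assms(2)
proof (induction k)
  case (Suc k)
  define u v where "u = (distF T ^^ k) x" and "v = (distF T ^^ k) y"
  have "2 ^ k * \<bar>x - y\<bar> \<le> \<bar>u - v\<bar>"
    unfolding u_def v_def by (rule Suc.IH) (use Suc.prems in \<open>simp add: same_itinerary_def\<close>)
  moreover obtain j where "j \<in> {0,1}" "u \<in> branch j" "v \<in> branch j"
    using Suc.prems unfolding same_itinerary_def u_def v_def by blast
  then have "2 * \<bar>u - v\<bar> \<le> \<bar>distF T u - distF T v\<bar>"
    using distF_expands[OF assms(1), of j u v] distF_expands[OF assms(1), of j v u]
    by (cases "u \<le> v") auto
  ultimately show ?case by (simp add: u_def v_def)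
qed simp

lemma itinerary_mem:
  assumes "admissible_T T" "same_itinerary T k x y" "x \<in> {0..1}"
  shows "(distF T ^^ k) x \<in> {0..1}"
proof (cases k)
  case (Suc m)
  then obtain j where "j \<in> {0,1}" "(distF T ^^ m) x \<in> branch j"
    using assms(2) unfolding same_itinerary_def by blast
  then have "distF T ((distF T ^^ m) x) \<in> {0..1}" using distF_image[OF assms(1)] by blast
  then show ?thesis using Suc by simp
qed (use assms in simp)

lemma same_itinerary_sym: "same_itinerary T k x y \<Longrightarrow> same_itinerary T k y x"
  unfolding same_itinerary_def by blast

lemma itinerary_close:
  assumes "admissible_T T" "same_itinerary T k x y" "x \<in> {0..1}" "y \<in> {0..1}"
  shows "\<bar>x - y\<bar> \<le> (1 / 2) ^ k"
proof -
  have "2 ^ k * \<bar>x - y\<bar> \<le> 1"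
    using itinerary_expands[OF assms(1,2)] itinerary_mem[OF assms(1,2,3)]
      itinerary_mem[OF assms(1) same_itinerary_sym[OF assms(2)] assms(4)] by auto
  then show ?thesis by (simp add: power_one_over field_simps)
qed

lemma same_itinerary_drop:
  assumes "same_itinerary T (a + b) x y"
  shows "same_itinerary T b ((distF T ^^ a) x) ((distF T ^^ a) y)"
  unfolding same_itinerary_def
proof (intro allI impI)
  fix i assume "i < b"
  then have "i + a < a + b" by simp
  then have "\<exists>j\<in>{0,1}. (distF T ^^ (i + a)) x \<in> branch j \<and> (distF T ^^ (i + a)) y \<in> branch j"
    using assms unfolding same_itinerary_def by blast
  then show "\<exists>j\<in>{0,1}. (distF T ^^ i) ((distF T ^^ a) x) \<in> branch j \<and>
      (distF T ^^ i) ((distF T ^^ a) y) \<in> branch j"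
    by (simp add: funpow_add)
qed

text \<open>On J 0 the map coincides with the chart A 0. Hence the first return is the time map of
the flow with time \<open>clock T m\<close>, up to the initial affine chart.\<close>

lemma first_return:
  assumes "x \<in> J m"
  shows "(distF T ^^ Suc m) x = Phi (clock T m) (A m x)"
    and "birkhoff T (Suc m) x = log_deriv (clock T m) (A m x)"
proof -
  let ?y = "(distF T ^^ m) x"
  have y: "?y \<in> J 0" using orbit_J(1)[OF assms order_refl] by simp
  then have "1/3 < ?y" by (simp add: J_0)
  then have "distF T ?y = A 0 ?y" "log_slope T ?y = 0"
    by (simp_all add: distF_right log_slope_right A_def)
  then show "(distF T ^^ Suc m) x = Phi (clock T m) (A m x)"
      "birkhoff T (Suc m) x = log_deriv (clock T m) (A m x)"
    using orbit_J(2,3)[OF assms order_refl, of T] by simp_all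
qed

text \<open>The distortion is compared with the distance of the image points, not of the initial points,
since it is the former that a long remaining itinerary makes small. The bounded time of the flow makes
the comparison uniform in m.\<close>

lemma first_return_distortion:
  assumes "0 \<le> T" "T \<le> 1" "x \<in> J m" "y \<in> J m"
  shows "\<bar>birkhoff T (Suc m) x - birkhoff T (Suc m) y\<bar>
    \<le> 40 * exp 4 * \<bar>(distF T ^^ Suc m) x - (distF T ^^ Suc m) y\<bar>"
proof -
  define s where "s = clock T m"
  define u v where "u = A m x" and "v = A m y"
  have s: "\<bar>s\<bar> \<le> 1" using clock_bounds[OF assms(1), of m] assms(2) by (auto simp: s_def)
  then have e: "exp (2 * \<bar>s\<bar>) \<le> exp 2" by simp
  \<comment> \<open>the inverse time map is again Lipschitz, which bounds initial distances by final ones\<close>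
  have inv: "z = Phi (- s) (Phi s z)" for z using Phi_add[of "-s" s z] by simp
  have "\<bar>u - v\<bar> \<le> exp (2 * \<bar>s\<bar>) * \<bar>Phi s u - Phi s v\<bar>"
    using Phi_lipschitz[of "-s" "Phi s u" "Phi s v"] inv[of u] inv[of v] by simp
  also have "\<dots> \<le> exp 2 * \<bar>Phi s u - Phi s v\<bar>" using e by (intro mult_right_mono) auto
  finally have uv: "\<bar>u - v\<bar> \<le> exp 2 * \<bar>Phi s u - Phi s v\<bar>" .
  have "\<bar>log_deriv s u - log_deriv s v\<bar> \<le> 40 * exp (2 * \<bar>s\<bar>) * \<bar>s\<bar> * \<bar>u - v\<bar>" by (rule log_deriv_lipschitz)
  also have "\<dots> \<le> 40 * exp 2 * 1 * (exp 2 * \<bar>Phi s u - Phi s v\<bar>)"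
    using e s uv by (intro mult_mono) auto
  also have "\<dots> = 40 * (exp 2 * exp 2) * \<bar>Phi s u - Phi s v\<bar>" by simp
  also have "exp 2 * exp 2 = exp (4::real)" by (simp flip: exp_add)
  finally show ?thesis
    unfolding first_return[OF assms(3)] first_return[OF assms(4)] s_def u_def v_def .
qed

text \<open>Strong induction on k splits off the first complete run. Its distortion is at most a constant
times the distance of the image points, which is at most \<open>(1 / 2) ^ l\<close> if l symbols remain.
This is the term by which the geometric sum for l grows when l is replaced by l + 1.\<close>

lemma itinerary_distortion:
  assumes T: "admissible_T T"
  shows "same_itinerary T k x y \<Longrightarrow> x \<in> {0..1} \<Longrightarrow> y \<in> {0..1} \<Longrightarrow>
    \<bar>birkhoff T k x - birkhoff T k y\<bar> \<le> 4 + 40 * exp 4 * (\<Sum>j<k. (1 / 2) ^ j)"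
proof (induction k arbitrary: x y rule: less_induct)
  case (less k)
  have T1: "0 \<le> T" "T \<le> 1" using T by (simp_all add: admissible_T_def)
  let ?F = "distF T" and ?K = "40 * exp 4 :: real"
  show ?case
  proof (cases "\<exists>i<k. (?F ^^ i) x \<in> {2/3..1}")
    case False
    have "(?F ^^ i) x \<in> {0..1/3} \<and> (?F ^^ i) y \<in> {0..1/3}" if "i < k" for i
      using less.prems(1) that False unfolding same_itinerary_def branch_def by fastforce
    then have "\<bar>birkhoff T k x\<bar> \<le> 2 * T" "\<bar>birkhoff T k y\<bar> \<le> 2 * T"
      by (auto intro!: left_run_bound T1(1) simp del: atLeastAtMost_iff)
    then have "\<bar>birkhoff T k x - birkhoff T k y\<bar> \<le> 4" using T1 by linarith
    moreover have "0 \<le> ?K * (\<Sum>j<k. (1 / 2) ^ j)" by (intro mult_nonneg_nonneg sum_nonneg) auto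
    ultimately show ?thesis by linarith
  next
    case True
    \<comment> \<open>the number of symbols 0 before the first symbol 1\<close>
    define m where "m = (LEAST i. i < k \<and> (?F ^^ i) x \<in> {2/3..1})"
    have m: "m < k" "(?F ^^ m) x \<in> {2/3..1}"
      using LeastI_ex[OF True[unfolded]] unfolding m_def by blast+
    have first: "(?F ^^ i) x \<notin> {2/3..1}" if "i < m" for i
      using not_less_Least[of i "\<lambda>i. i < k \<and> (?F ^^ i) x \<in> {2/3..1}"] that m(1)
      unfolding m_def by (meson less_trans)
    have side: "\<exists>j\<in>{0,1}. (?F ^^ i) x \<in> branch j \<and> (?F ^^ i) y \<in> branch j" if "i < k" for i
      using less.prems(1) that unfolding same_itinerary_def by blast
    have left: "(?F ^^ i) x \<in> {0..1/3}" "(?F ^^ i) y \<in> {0..1/3}" if "i < m" for i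
    proof -
      have "i < k" using that m(1) by simp
      from side[OF this] first[OF that]
      show "(?F ^^ i) x \<in> {0..1/3}" "(?F ^^ i) y \<in> {0..1/3}"
        by (auto simp only: branch_def insert_iff empty_iff split: if_splits)
    qed
    have "(?F ^^ m) y \<in> {2/3..1}"
      using side[OF m(1)] m(2) by (auto simp: branch_def)
    then have xy: "x \<in> J m" "y \<in> J m"
      using J_pullback[of m T x 0] J_pullback[of m T y 0] left m(2) by (simp_all only: J_0 add_0)
    define l where "l = k - Suc m"
    have k: "k = Suc m + l" using m(1) by (simp add: l_def)
    define x' y' where "x' = (?F ^^ Suc m) x" and "y' = (?F ^^ Suc m) y"
    have it: "same_itinerary T l x' y'"
      using same_itinerary_drop[of T "Suc m" l x y] less.prems(1) unfolding k x'_def y'_def .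
    have mem: "x' \<in> {0..1}" "y' \<in> {0..1}"
      unfolding x'_def y'_def first_return[OF xy(1)] first_return[OF xy(2)]
      using xy by (auto intro!: Phi_mem simp only: A_mem_iff)
    have "\<bar>birkhoff T (Suc m) x - birkhoff T (Suc m) y\<bar> \<le> ?K * \<bar>x' - y'\<bar>"
      unfolding x'_def y'_def by (rule first_return_distortion[OF T1 xy])
    also have "\<dots> \<le> ?K * (1 / 2) ^ l"
      by (intro mult_left_mono itinerary_close[OF T it mem]) simp
    finally have a: "\<bar>birkhoff T (Suc m) x - birkhoff T (Suc m) y\<bar> \<le> ?K * (1 / 2) ^ l" .
    have b: "\<bar>birkhoff T l x' - birkhoff T l y'\<bar> \<le> 4 + ?K * (\<Sum>j<l. (1 / 2) ^ j)"
      by (rule less.IH[OF _ it mem]) (simp add: k)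
    have "\<bar>birkhoff T k x - birkhoff T k y\<bar>
        \<le> \<bar>birkhoff T (Suc m) x - birkhoff T (Suc m) y\<bar> + \<bar>birkhoff T l x' - birkhoff T l y'\<bar>"
      unfolding k birkhoff_add x'_def y'_def by linarith
    also have "\<dots> \<le> 4 + ?K * (\<Sum>j<Suc l. (1 / 2) ^ j)"
      using a b by (simp add: distrib_left)
    also have "\<dots> \<le> 4 + ?K * (\<Sum>j<k. (1 / 2) ^ j)"
      by (intro add_left_mono mult_left_mono sum_mono2) (auto simp: k)
    finally show ?thesis .
  qed
qed

lemma geometric_half: "(\<Sum>j<k. (1 / 2 :: real) ^ j) \<le> 2"
proof -
  have "(\<Sum>j<k. (1 / 2 :: real) ^ j) = 2 - 2 * (1 / 2) ^ k" by (induction k) auto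
  then show ?thesis by simp
qed

section \<open>Cylinders and derivatives of iterates\<close>

lemma cylinder_Cons:
  "cylinder branch F (i # w) = {x \<in> branch i. F x \<in> cylinder branch F w}"
proof -
  have "(\<forall>j<length (i # w). (F ^^ j) x \<in> branch ((i # w) ! j)) \<longleftrightarrow>
      x \<in> branch i \<and> (\<forall>j<length w. (F ^^ j) (F x) \<in> branch (w ! j))" for x
    unfolding length_Cons All_less_Suc2 by (simp add: funpow_swap1)
  then show ?thesis unfolding cylinder_def by blast
qed

lemma cylinder_interval:
  assumes T: "admissible_T T" and "set w \<subseteq> {0, 1}"
  shows "is_interval (cylinder branch (distF T) w)"
  using assms(2)
proof (induction w)
  case Nil
  then show ?case by (simp add: cylinder_def)
next
  case (Cons i w)
  then have i: "i \<in> {0, 1}" and IH: "is_interval (cylinder branch (distF T) w)" by simp_all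
  show ?case unfolding is_interval_1 cylinder_Cons
  proof (intro ballI allI impI)
    fix a b x
    assume "a \<in> {x \<in> branch i. distF T x \<in> cylinder branch (distF T) w}"
      and "b \<in> {x \<in> branch i. distF T x \<in> cylinder branch (distF T) w}"
      and x: "a \<le> x \<and> x \<le> b"
    then have ab: "a \<in> branch i" "b \<in> branch i"
        and F: "distF T a \<in> cylinder branch (distF T) w" "distF T b \<in> cylinder branch (distF T) w"
      by blast+
    obtain c d where "branch i = {c..d}" using branch_Icc by blast
    with ab x have xi: "x \<in> branch i" by simp
    have "distF T a \<le> distF T x" "distF T x \<le> distF T b"
      by (rule distF_mono[OF T i]; use ab xi x in blast)+
    then have "distF T x \<in> cylinder branch (distF T) w"
      using IH F unfolding is_interval_1 by blast
    with xi show "x \<in> {x \<in> branch i. distF T x \<in> cylinder branch (distF T) w}" by blast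
  qed
qed

text \<open>Cylinders contain at least two points, because F^k maps them onto the unit interval. As they are
intervals, they have no isolated points, and derivatives within them are unique.\<close>

lemma cylinder_onto:
  assumes T: "admissible_T T" and "set w \<subseteq> {0, 1}" "t \<in> {0..1}"
  shows "\<exists>x\<in>{0..1} \<inter> cylinder branch (distF T) w. (distF T ^^ length w) x = t"
  using assms(2)
proof (induction w)
  case Nil
  then show ?case using assms(3) by (intro bexI[of _ t]) (simp_all add: cylinder_def)
next
  case (Cons i w)
  then have i: "i \<in> {0, 1}" by simp
  have "set w \<subseteq> {0, 1}" using Cons.prems by simp
  from Cons.IH[OF this] obtain y where y: "y \<in> {0..1}" "y \<in> cylinder branch (distF T) w"
      "(distF T ^^ length w) y = t" by blast
  have "y \<in> distF T ` branch i" using y(1) unfolding distF_image[OF T i] .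
  then obtain x where x: "x \<in> branch i" "distF T x = y" by (elim imageE) simp
  have "x \<in> {0..1}" using x(1) by (auto simp: branch_def split: if_splits)
  moreover have "x \<in> cylinder branch (distF T) (i # w)"
    unfolding cylinder_Cons using x y(2) by simp
  moreover have "(distF T ^^ length (i # w)) x = t"
    unfolding length_Cons funpow_Suc_right comp_apply x(2) by (rule y(3))
  ultimately show ?case by blast
qed

lemma cylinder_limpt:
  assumes T: "admissible_T T" and w: "set w \<subseteq> {0, 1}" and x: "x \<in> cylinder branch (distF T) w"
  shows "x islimpt cylinder branch (distF T) w"
proof -
  obtain a where a: "a \<in> cylinder branch (distF T) w" "(distF T ^^ length w) a = 0"
    using cylinder_onto[OF T w, of 0] by auto
  obtain b where b: "b \<in> cylinder branch (distF T) w" "(distF T ^^ length w) b = 1"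
    using cylinder_onto[OF T w, of 1] by auto
  show ?thesis
    by (rule islimpt_connected[OF _ x a(1) b(1)])
       (use a(2) b(2) cylinder_interval[OF T w] is_interval_connected in auto)
qed

lemma cylinder_orbit_mem:
  assumes "set w \<subseteq> {0, 1}" "x \<in> cylinder branch F w" "i < length w"
  shows "w ! i \<in> {0, 1}" "(F ^^ i) x \<in> branch (w ! i)" "(F ^^ i) x \<in> domainF"
proof -
  show *: "w ! i \<in> {0, 1}" using assms(1,3) nth_mem by blast
  show **: "(F ^^ i) x \<in> branch (w ! i)" using assms(2,3) by (simp add: cylinder_def)
  show "(F ^^ i) x \<in> domainF" using * ** branch_Icc by blast
qed

lemma iterate_DERIV:
  assumes w: "set w \<subseteq> {0, 1}" and x: "x \<in> cylinder branch (distF T) w"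
  shows "k \<le> length w \<Longrightarrow> ((distF T ^^ k) has_real_derivative 3 ^ k * exp (birkhoff T k x))
    (at x within cylinder branch (distF T) w)"
proof (induction k)
  case 0
  then show ?case by (simp add: id_def)
next
  case (Suc k)
  let ?C = "cylinder branch (distF T) w" and ?y = "(distF T ^^ k) x"
  have sub: "(distF T ^^ k) ` ?C \<subseteq> domainF"
  proof
    fix z assume "z \<in> (distF T ^^ k) ` ?C"
    then obtain u where "u \<in> ?C" "z = (distF T ^^ k) u" by (rule imageE)
    then show "z \<in> domainF" using cylinder_orbit_mem(3)[OF w, of u "distF T" k] Suc.prems by simp
  qed
  have "(distF T has_real_derivative 3 * exp (log_slope T ?y)) (at ?y within (distF T ^^ k) ` ?C)"
    by (rule DERIV_subset[OF distF_DERIV sub]) (use sub x in blast)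
  then have "(distF T \<circ> (distF T ^^ k) has_real_derivative
      3 * exp (log_slope T ?y) * (3 ^ k * exp (birkhoff T k x))) (at x within ?C)"
    by (rule DERIV_image_chain) (use Suc in simp)
  then show ?case by (simp add: exp_add ac_simps o_def)
qed

lemma iterate_deriv:
  assumes "admissible_T T" "w \<in> words k" "x \<in> cylinder branch (distF T) w"
  shows "deriv_within (cylinder branch (distF T) w) (distF T ^^ k) x = 3 ^ k * exp (birkhoff T k x)"
  using assms by (intro deriv_within_eq iterate_DERIV cylinder_limpt) (auto simp: words_def)

lemma distF_BD:
  assumes T: "admissible_T T"
  shows "BD branch (distF T)"
proof -
  define C where "C = exp (4 + 40 * exp 4 * 2 :: real)"
  have "deriv_within (cylinder branch (distF T) w) (distF T ^^ k) x /
      deriv_within (cylinder branch (distF T) w) (distF T ^^ k) y \<le> C"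
    if k: "0 < k" and w: "w \<in> words k"
      and x: "x \<in> cylinder branch (distF T) w" and y: "y \<in> cylinder branch (distF T) w" for k w x y
  proof -
    have w': "set w \<subseteq> {0, 1}" "length w = k" using w by (simp_all add: words_def)
    have it: "same_itinerary T k x y"
      unfolding same_itinerary_def
      using cylinder_orbit_mem(1,2)[OF w'(1) x] cylinder_orbit_mem(1,2)[OF w'(1) y] w'(2) by blast
    have "x \<in> {0..1}" "y \<in> {0..1}"
      using cylinder_orbit_mem(3)[OF w'(1) x, of 0] cylinder_orbit_mem(3)[OF w'(1) y, of 0] k w'(2)
      by auto
    from itinerary_distortion[OF T it this]
    have "birkhoff T k x - birkhoff T k y \<le> 4 + 40 * exp 4 * (\<Sum>j<k. (1 / 2) ^ j)" by linarith
    also have "\<dots> \<le> 4 + 40 * exp 4 * 2"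
      by (intro add_left_mono mult_left_mono geometric_half) simp
    finally show ?thesis
      unfolding iterate_deriv[OF T w x] iterate_deriv[OF T w y] C_def by (simp flip: exp_diff)
  qed
  moreover have "1 \<le> C" by (simp add: C_def)
  ultimately show ?thesis unfolding BD_def by blast
qed

section \<open>Failure of strong bounded distortion\<close>

text \<open>The flow moves 1/2 to the right and fixes 0, so the mean slope of the time t map on the left
half of the unit interval exceeds 1.\<close>

lemma log_deriv_positive_somewhere:
  assumes "0 < t"
  shows "\<exists>a\<in>{0..1}. 0 < log_deriv t a"
proof -
  have "\<exists>s. 0 < s \<and> s < t \<and> Phi t (1/2) - Phi 0 (1/2) = (t - 0) * X (Phi s (1/2))"
    by (rule MVT2[OF assms]) (rule Phi_DERIV_time)
  then obtain s where "Phi t (1/2) - 1/2 = t * X (Phi s (1/2))" by auto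
  moreover have "0 < X (Phi s (1/2))" using Phi_interior[of "1/2" s] X_pos by simp
  ultimately have right: "1/2 < Phi t (1/2)" using assms by (smt (verit) mult_pos_pos)
  have "\<exists>a. 0 < a \<and> a < 1/2 \<and> Phi t (1/2) - Phi t 0 = (1/2 - 0) * exp (log_deriv t a)"
    by (rule MVT2) (simp, rule Phi_DERIV)
  then obtain a where a: "0 < a" "a < 1/2" "Phi t (1/2) - Phi t 0 = (1/2 - 0) * exp (log_deriv t a)" by blast
  have "1 < exp (log_deriv t a)" using a(3) right Phi_outside[of 0 t] by simp
  then show ?thesis using a(1,2) by (intro bexI[of _ a]) auto
qed

text \<open>With \<open>q = 2 ^ (2 * r) - 1\<close> and \<open>n = 2 ^ (2 * r + 1) - 1\<close>, the steps from J n to J q use exactly the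
block of times equal to \<open>T / 2 ^ (2 * r)\<close>, whose sum is T. The points of J n with chart
coordinates a and 0 then have ratio of derivatives \<open>exp (log_deriv T a) > 1\<close>, independently of r,
while the image of the segment between them lies in J q, which is shorter than 1 / r.\<close>

lemma distF_not_SBD:
  assumes T: "admissible_T T"
  shows "\<not> SBD branch (distF T)"
proof
  assume "SBD branch (distF T)"
  then obtain \<beta> :: "nat \<Rightarrow> real" where lim: "\<beta> \<longlonglongrightarrow> 1" and
    *: "\<forall>k>0. \<forall>r\<ge>1. \<forall>w\<in>words k.
      \<forall>x\<in>cylinder branch (distF T) w. \<forall>y\<in>cylinder branch (distF T) w.
        diameter ((distF T ^^ k) ` closed_segment x y) \<le> 1 / real r \<longrightarrow>
        deriv_within (cylinder branch (distF T) w) (distF T ^^ k) x /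
        deriv_within (cylinder branch (distF T) w) (distF T ^^ k) y \<le> \<beta> r"
    unfolding SBD_def by (elim exE conjE)
  note \<beta> = *[rule_format]
  have "0 < T" using T by (simp add: admissible_T_def)
  then obtain a where a: "a \<in> {0..1}" "0 < log_deriv T a" using log_deriv_positive_somewhere by blast
  have "exp (log_deriv T a) \<le> \<beta> r" if r: "r \<ge> 1" for r
  proof -
    define p where "p = (2::nat) ^ (2 * r)"
    define q where "q = p - 1"
    define n where "n = q + p"
    have p: "0 < p" "p \<le> n" "n - p = q" by (simp_all add: p_def n_def)
    have n: "n = 2 ^ Suc (2 * r) - 1" by (simp add: n_def q_def p_def)
    have clock: "clock T n - clock T q = T"
      unfolding n q_def p_def clock_block_end by simp
    define P where "P z = (z + 2) / 3 ^ (n + 1)" for z :: real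
    have AP: "A n (P z) = z" for z by (simp add: P_def A_def)
    have PJ: "P z \<in> J n" if "z \<in> {0..1}" for z using that by (simp only: A_mem_iff[symmetric] AP)
    define w where "w = replicate p (0::nat)"
    have w: "w \<in> words p" by (auto simp: w_def words_def)
    have cyl: "x \<in> cylinder branch (distF T) w" if "x \<in> J n" for x
    proof -
      have "(distF T ^^ i) x \<in> {0..1/3}" if "i < p" for i
      proof -
        have "(distF T ^^ i) x \<in> J (n - i)" by (rule orbit_J(1)[OF \<open>x \<in> J n\<close>]) (use that p(2) in linarith)
        moreover have "1 \<le> n - i" using that p(2) by linarith
        ultimately show ?thesis using J_le_third by force
      qed
      then show ?thesis by (simp add: cylinder_def w_def branch_def)
    qed
    have birk: "birkhoff T p (P z) = log_deriv T z" if "z \<in> {0..1}" for z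
      using orbit_J(3)[OF PJ[OF that] p(2), of T] by (simp only: p(3) clock AP)
    have img: "(distF T ^^ p) ` closed_segment (P a) (P 0) \<subseteq> J q"
    proof -
      have "closed_segment (P a) (P 0) \<subseteq> J n"
        using PJ[OF a(1)] PJ[of 0] by (intro closed_segment_subset) (simp_all add: J_def)
      then show ?thesis using orbit_J(1)[OF _ p(2), of _ T] unfolding p(3) by blast
    qed
    have "r \<le> 2 * r" by simp
    also have "\<dots> < p" unfolding p_def by (rule less_exp)
    finally have "r < p" .
    then have "r \<le> q" by (simp add: q_def)
    have "real r \<le> 3 ^ q"
    proof -
      have "r < 2 ^ r" by (rule less_exp)
      also have "(2::nat) ^ r \<le> 3 ^ r" by (rule power_mono) simp_all
      also have "(3::nat) ^ r \<le> 3 ^ q" using \<open>r \<le> q\<close> by (intro power_increasing) simp_all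
      finally have "real r \<le> real (3 ^ q)" by (intro of_nat_mono) simp
      then show ?thesis by simp
    qed
    then have q: "1 / 3 ^ q \<le> 1 / real r" using r by (intro divide_left_mono) auto
    have "diameter ((distF T ^^ p) ` closed_segment (P a) (P 0)) \<le> 1 / real r"
    proof (rule diameter_le)
      fix u v
      assume "u \<in> (distF T ^^ p) ` closed_segment (P a) (P 0)"
        "v \<in> (distF T ^^ p) ` closed_segment (P a) (P 0)"
      with img have "u \<in> J q" "v \<in> J q" by blast+
      then have "2 / 3 ^ (q + 1) \<le> u" "u \<le> 1 / 3 ^ q" "2 / 3 ^ (q + 1) \<le> v" "v \<le> 1 / 3 ^ q"
        by (simp_all only: J_def atLeastAtMost_iff)
      moreover have "(0::real) \<le> 2 / 3 ^ (q + 1)" by simp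
      ultimately have "\<bar>u - v\<bar> \<le> 1 / 3 ^ q" by linarith
      then show "norm (u - v) \<le> 1 / real r" using q by simp
    qed simp
    moreover have zero: "(0::real) \<in> {0..1}" by simp
    ultimately have "deriv_within (cylinder branch (distF T) w) (distF T ^^ p) (P a) /
        deriv_within (cylinder branch (distF T) w) (distF T ^^ p) (P 0) \<le> \<beta> r"
      by (intro \<beta>[OF p(1) r w] cyl PJ a(1))
    then have "3 ^ p * exp (log_deriv T a) / (3 ^ p * exp (log_deriv T 0)) \<le> \<beta> r"
      unfolding iterate_deriv[OF T w cyl[OF PJ[OF a(1)]]] iterate_deriv[OF T w cyl[OF PJ[OF zero]]]
        birk[OF a(1)] birk[OF zero] .
    then show ?thesis by (simp add: log_deriv_outside)
  qed
  then have "\<exists>N. \<forall>r\<ge>N. exp (log_deriv T a) \<le> \<beta> r" by blast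
  then have "exp (log_deriv T a) \<le> 1" by (rule LIMSEQ_le_const[OF lim])
  then show False using a(2) by simp
qed

theorem mainTheorem1:
  shows "(\<exists>T. admissible_T T) \<and>
    (\<forall>T. admissible_T T \<longrightarrow>
       C1_expanding branch (distF T) \<and> BD branch (distF T) \<and> \<not> SBD branch (distF T))"
  using admissible_exists distF_expanding distF_BD distF_not_SBD by blast

end
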